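(* For all $k\ge1$, the problem $\mathsf{CSP}[\mathcal{H}(\mathsf{coverwidth}\le k)]$ is decidable in polynomial time by the projective $k$-consistency algorithm. In particular, on an instance of $\mathsf{CSP}[\mathcal{H}(\mathsf{coverwidth}\le k)]$, the projective $k$-consistency algorithm reports an inconsistency if and only if the instance is not satisfiable.
   Context: A CSP instance is a pair $\mathbf{A},\mathbf{B}$ of finite relational structures over the same finite relational signature; it is satisfiable if there is a homomorphism $\mathbf{A}\to\mathbf{B}$ (a map $h:A\to B$ with $(h(a_1),\ldots,h(a_r))\in R^{\mathbf{B}}$ for all $(a_1,\ldots,a_r)\in R^{\mathbf{A}}$). Structures $\mathbf{A},\mathbf{A}'$ are homomorphically equivalent if there are homomorphisms $\mathbf{A}\to\mathbf{A}'$ and $\mathbf{A}'\to\mathbf{A}$. $H(\mathbf{A})$ is the hypergraph on $A$ with a hyperedge $\{a_1,\ldots,a_r\}$ per tuple of any relation of $\mathbf{A}$. A $k$-union is a union of $k$ hyperedges (the empty set being the $0$-union); the weight of $X\subseteq A$ is the least $k\ge0$ with $X\cap\bigcup_e e$ contained in a $k$-union. A tree decomposition of $H(\mathbf{A})$ is a tree with bags $X_i\subseteq A$ covering $A$, each hyperedge inside some bag, and for each vertex the bags containing it forming a connected subtree; its weight is its maximal bag weight; the coverwidth of $\mathbf{A}$ is the minimal weight of a tree decomposition. $\mathsf{CSP}[\mathcal{H}(\mathsf{coverwidth}\le k)]$ is the CSP restricted to instances $\mathbf{A},\mathbf{B}$ where $\mathbf{A}$ is homomorphically equivalent to some relational structure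 of coverwidth $\le k$. A projective homomorphism from $\mathbf{A}$ to $\mathbf{B}$ is a partial function $h$ from $A$ to $B$ such that for every $R$ and $(a_1,\ldots,a_r)\in R^{\mathbf{A}}$ there is $(b_1,\ldots,b_r)\in R^{\mathbf{B}}$ with $h(a_i)=b_i$ for all $a_i\in\mathsf{dom}(h)$. The projective $k$-consistency algorithm on $\mathbf{A},\mathbf{B}$: form $\mathbf{A}',\mathbf{B}'$ with universes $A,B$ and a relation symbol $R_U$ for each $k$-union $U$ over $\mathbf{A}$, where $R_U^{\mathbf{A}'}$ contains only the tuple $(u_1,\ldots,u_m)$ listing $U$ in a fixed order and $R_U^{\mathbf{B}'}$ contains all $(b_1,\ldots,b_m)$ such that $u_i\mapsto b_i$ is a projective homomorphism from $\mathbf{A}$ to $\mathbf{B}$; then repeatedly remove any $\mathbf{B}'$-tuple $(b_1,\ldots,b_m)\in R_U^{\mathbf{B}'}$ for which $u_i\mapsto b_i$ is not a projective homomorphism from $\mathbf{A}'$ to $\mathbf{B}'$, until no change; report an inconsistency iff no $\mathbf{B}'$-tuples remain.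
   Formalization: Universes are taken nonempty and the hyperedges of a k-union may repeat; if A has no tuples, the empty set counts as its only k-union, since otherwise there is no R_U and the algorithm would report an inconsistency on a satisfiable instance. *)

theory Defs
  imports Main "HOL-Computational_Algebra.Polynomial"
begin

section \<open>Relational structures\<close>

text \<open>A signature is a finite partial map from relation symbols to arities. Nullary symbols are
allowed; universes are nonempty, as is customary.\<close>

record ('s, 'a) rel_struct =
  signat :: "'s \<rightharpoonup> nat"
  univ :: "'a set"
  rels :: "'s \<Rightarrow> 'a list set"

definition finite_structure :: "('s, 'a) rel_struct \<Rightarrow> bool" where
  "finite_structure A \<longleftrightarrow>
     finite (dom (signat A)) \<and> finite (univ A) \<and> univ A \<noteq> {} \<and>
     (\<forall>R. \<forall>as \<in> rels A R. signat A R = Some (length as) \<and> set as \<subseteq> univ A)"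

definition homomorphism ::
    "('s, 'a) rel_struct \<Rightarrow> ('s, 'b) rel_struct \<Rightarrow> ('a \<Rightarrow> 'b) \<Rightarrow> bool" where
  "homomorphism A B h \<longleftrightarrow>
     h ` univ A \<subseteq> univ B \<and> (\<forall>R. \<forall>as \<in> rels A R. map h as \<in> rels B R)"

definition csp_instance :: "('s, 'a) rel_struct \<Rightarrow> ('s, 'b) rel_struct \<Rightarrow> bool" where
  "csp_instance A B \<longleftrightarrow> finite_structure A \<and> finite_structure B \<and> signat A = signat B"

definition satisfiable :: "('s, 'a) rel_struct \<Rightarrow> ('s, 'b) rel_struct \<Rightarrow> bool" where
  "satisfiable A B \<longleftrightarrow> (\<exists>h. homomorphism A B h)"

definition hom_equivalent :: "('s, 'a) rel_struct \<Rightarrow> ('s, 'b) rel_struct \<Rightarrow> bool" where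
  "hom_equivalent A C \<longleftrightarrow>
     signat A = signat C \<and> (\<exists>h. homomorphism A C h) \<and> (\<exists>h. homomorphism C A h)"


section \<open>Coverwidth\<close>

definition hyperedges :: "('s, 'a) rel_struct \<Rightarrow> 'a set set" where
  "hyperedges A = {set as | R as. as \<in> rels A R}"

text \<open>The \<open>k\<close> hyperedges of a \<open>k\<close>-union need not be distinct. In a hypergraph without hyperedges
the only union that can be formed, the empty one, counts as a \<open>k\<close>-union for every \<open>k\<close>.\<close>

definition k_unions :: "nat \<Rightarrow> 'a set set \<Rightarrow> 'a set set" where
  "k_unions k E =
     (if E = {} then {{}} else {\<Union>(set es) | es. length es = k \<and> set es \<subseteq> E})"

definition weight :: "'a set set \<Rightarrow> 'a set \<Rightarrow> nat" where
  "weight E X = (LEAST k. \<exists>U \<in> k_unions k E. X \<inter> \<Union>E \<subseteq> U)"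

definition connected_in :: "('t \<times> 't) set \<Rightarrow> 't set \<Rightarrow> bool" where
  "connected_in F S \<longleftrightarrow> (\<forall>s \<in> S. \<forall>t \<in> S. (s, t) \<in> (F \<inter> S \<times> S)\<^sup>*)"

definition has_cycle :: "('t \<times> 't) set \<Rightarrow> bool" where
  "has_cycle F \<longleftrightarrow>
     (\<exists>cs. length cs \<ge> 3 \<and> distinct cs \<and> successively (\<lambda>s t. (s, t) \<in> F) cs \<and>
        (last cs, hd cs) \<in> F)"

definition is_tree :: "'t set \<Rightarrow> ('t \<times> 't) set \<Rightarrow> bool" where
  "is_tree N F \<longleftrightarrow>
     finite N \<and> N \<noteq> {} \<and> F \<subseteq> N \<times> N \<and> sym F \<and> irrefl F \<and>
     connected_in F N \<and> \<not> has_cycle F"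

definition tree_decomposition ::
    "'a set \<Rightarrow> 'a set set \<Rightarrow> 't set \<Rightarrow> ('t \<times> 't) set \<Rightarrow> ('t \<Rightarrow> 'a set) \<Rightarrow> bool" where
  "tree_decomposition V E N F X \<longleftrightarrow>
     is_tree N F \<and> (\<Union>t \<in> N. X t) = V \<and>
     (\<forall>e \<in> E. \<exists>t \<in> N. e \<subseteq> X t) \<and>
     (\<forall>v \<in> V. connected_in F {t \<in> N. v \<in> X t})"

definition decomposition_weight :: "'a set set \<Rightarrow> 't set \<Rightarrow> ('t \<Rightarrow> 'a set) \<Rightarrow> nat" where
  "decomposition_weight E N X = Max ((\<lambda>t. weight E (X t)) ` N)"

text \<open>Finite trees may be assumed to have natural numbers as nodes.\<close>

definition coverwidth :: "('s, 'a) rel_struct \<Rightarrow> nat" where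
  "coverwidth A =
     (LEAST w. \<exists>(N :: nat set) F X.
        tree_decomposition (univ A) (hyperedges A) N F X \<and>
        decomposition_weight (hyperedges A) N X = w)"

text \<open>The instances of \<open>CSP[H(coverwidth \<le> k)]\<close>. Every finite structure is isomorphic to one whose
universe consists of natural numbers, so quantifying over such structures loses nothing.\<close>

definition csp_coverwidth_instance ::
    "nat \<Rightarrow> ('s, 'a) rel_struct \<Rightarrow> ('s, 'b) rel_struct \<Rightarrow> bool" where
  "csp_coverwidth_instance k A B \<longleftrightarrow>
     csp_instance A B \<and>
     (\<exists>C :: ('s, nat) rel_struct.
        finite_structure C \<and> hom_equivalent A C \<and> coverwidth C \<le> k)"


section \<open>Projective consistency\<close>

definition projective_homomorphism ::
    "('s, 'a) rel_struct \<Rightarrow> ('s, 'b) rel_struct \<Rightarrow> ('a \<rightharpoonup> 'b) \<Rightarrow> bool" where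
  "projective_homomorphism A B h \<longleftrightarrow>
     dom h \<subseteq> univ A \<and> ran h \<subseteq> univ B \<and>
     (\<forall>R. \<forall>as \<in> rels A R. \<exists>bs \<in> rels B R.
        \<forall>i < length as. as ! i \<in> dom h \<longrightarrow> h (as ! i) = Some (bs ! i))"

definition listing :: "'a set \<Rightarrow> 'a list" where
  "listing U = (SOME us. distinct us \<and> set us = U)"

definition tuple_map :: "'a set \<Rightarrow> 'b list \<Rightarrow> ('a \<rightharpoonup> 'b)" where
  "tuple_map U bs = map_of (zip (listing U) bs)"

text \<open>In the structures \<open>A'\<close> and \<open>B'\<close> built by the algorithm, the \<open>k\<close>-union \<open>U\<close> itself serves as
the relation symbol \<open>R_U\<close>.\<close>

definition union_signat :: "nat \<Rightarrow> ('s, 'a) rel_struct \<Rightarrow> ('a set \<rightharpoonup> nat)" where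
  "union_signat k A = (\<lambda>U. if U \<in> k_unions k (hyperedges A) then Some (card U) else None)"

definition union_source :: "nat \<Rightarrow> ('s, 'a) rel_struct \<Rightarrow> ('a set, 'a) rel_struct" where
  "union_source k A =
     \<lparr> signat = union_signat k A,
       univ = univ A,
       rels = (\<lambda>U. if U \<in> k_unions k (hyperedges A) then {listing U} else {}) \<rparr>"

definition union_target ::
    "nat \<Rightarrow> ('s, 'a) rel_struct \<Rightarrow> ('s, 'b) rel_struct \<Rightarrow> ('a set, 'b) rel_struct" where
  "union_target k A B =
     \<lparr> signat = union_signat k A,
       univ = univ B,
       rels = (\<lambda>U. if U \<in> k_unions k (hyperedges A)
                   then {bs. length bs = card U \<and> set bs \<subseteq> univ B \<and>
                             projective_homomorphism A B (tuple_map U bs)}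
                   else {}) \<rparr>"

definition prune_step ::
    "('a set, 'a) rel_struct \<Rightarrow> ('a set, 'b) rel_struct \<Rightarrow> ('a set, 'b) rel_struct \<Rightarrow> bool" where
  "prune_step A' B\<^sub>1 B\<^sub>2 \<longleftrightarrow>
     (\<exists>U. \<exists>bs \<in> rels B\<^sub>1 U.
        \<not> projective_homomorphism A' B\<^sub>1 (tuple_map U bs) \<and>
        B\<^sub>2 = B\<^sub>1\<lparr>rels := (rels B\<^sub>1)(U := rels B\<^sub>1 U - {bs})\<rparr>)"

text \<open>\<open>pkc_result k A B B'\<close>: some run of the projective \<open>k\<close>-consistency algorithm on \<open>A\<close>, \<open>B\<close>, with
removals in an arbitrary order, stops with the structure \<open>B'\<close>.\<close>

definition pkc_result ::
    "nat \<Rightarrow> ('s, 'a) rel_struct \<Rightarrow> ('s, 'b) rel_struct \<Rightarrow> ('a set, 'b) rel_struct \<Rightarrow> bool" where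
  "pkc_result k A B B' \<longleftrightarrow>
     (prune_step (union_source k A))\<^sup>*\<^sup>* (union_target k A B) B' \<and>
     \<not> (\<exists>B''. prune_step (union_source k A) B' B'')"

definition reports_inconsistency :: "('a set, 'b) rel_struct \<Rightarrow> bool" where
  "reports_inconsistency B' \<longleftrightarrow> (\<forall>U. rels B' U = {})"


section \<open>Polynomial time\<close>

text \<open>The machine model is a first-order call-by-value functional language on binary trees
in the style of N. D. Jones, \<^emph>\<open>Computability and Complexity from a Programming Perspective\<close>.
Every evaluation step costs one unit. Subtrees can be shared in a heap and the only test is whether
a tree is a leaf, so a Turing machine simulates \<open>n\<close> steps of a fixed program in time polynomial
in \<open>n\<close> and the input size; polynomial time in this model is therefore the usual notion.\<close>

datatype data = Leaf | Node data data

fun left :: "data \<Rightarrow> data" where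
  "left Leaf = Leaf"
| "left (Node l r) = l"

fun right :: "data \<Rightarrow> data" where
  "right Leaf = Leaf"
| "right (Node l r) = r"

datatype expr =
    Var nat
  | ELeaf
  | ENode expr expr
  | ELeft expr
  | ERight expr
  | If expr expr expr
  | Call nat "expr list"

text \<open>A program is a list of function bodies. \<open>Call f es\<close> invokes the \<open>f\<close>-th one, in whose body
\<open>Var i\<close> denotes the \<open>i\<close>-th argument.\<close>

type_synonym program = "expr list"

inductive
  eval :: "program \<Rightarrow> data list \<Rightarrow> expr \<Rightarrow> data \<Rightarrow> nat \<Rightarrow> bool" and
  evals :: "program \<Rightarrow> data list \<Rightarrow> expr list \<Rightarrow> data list \<Rightarrow> nat \<Rightarrow> bool"
  for P :: program
where
  eval_Var: "i < length env \<Longrightarrow> eval P env (Var i) (env ! i) 1"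
| eval_Leaf: "eval P env ELeaf Leaf 1"
| eval_Node: "eval P env e\<^sub>1 v\<^sub>1 n\<^sub>1 \<Longrightarrow> eval P env e\<^sub>2 v\<^sub>2 n\<^sub>2 \<Longrightarrow>
    eval P env (ENode e\<^sub>1 e\<^sub>2) (Node v\<^sub>1 v\<^sub>2) (n\<^sub>1 + n\<^sub>2 + 1)"
| eval_Left: "eval P env e v n \<Longrightarrow> eval P env (ELeft e) (left v) (n + 1)"
| eval_Right: "eval P env e v n \<Longrightarrow> eval P env (ERight e) (right v) (n + 1)"
| eval_If_True: "eval P env c v m \<Longrightarrow> v \<noteq> Leaf \<Longrightarrow> eval P env e\<^sub>1 w n \<Longrightarrow>
    eval P env (If c e\<^sub>1 e\<^sub>2) w (m + n + 1)"
| eval_If_False: "eval P env c Leaf m \<Longrightarrow> eval P env e\<^sub>2 w n \<Longrightarrow>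
    eval P env (If c e\<^sub>1 e\<^sub>2) w (m + n + 1)"
| eval_Call: "f < length P \<Longrightarrow> evals P env es vs m \<Longrightarrow> eval P vs (P ! f) w n \<Longrightarrow>
    eval P env (Call f es) w (m + n + 1)"
| evals_Nil: "evals P env [] [] 0"
| evals_Cons: "eval P env e v m \<Longrightarrow> evals P env es vs n \<Longrightarrow>
    evals P env (e # es) (v # vs) (m + n)"

definition runs :: "program \<Rightarrow> data \<Rightarrow> data \<Rightarrow> nat \<Rightarrow> bool" where
  "runs P v w n \<longleftrightarrow> eval P [v] (Call 0 [Var 0]) w n"

fun code_list :: "data list \<Rightarrow> data" where
  "code_list [] = Leaf"
| "code_list (v # vs) = Node v (code_list vs)"

text \<open>For structures that serve as inputs, relation symbols and elements are themselves trees.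
A structure is given explicitly by listing, in any order, its universe and its relational tuples,
each together with its relation symbol. Symbols without tuples need not be mentioned.\<close>

definition codes_structure :: "(data, data) rel_struct \<Rightarrow> data \<Rightarrow> bool" where
  "codes_structure A v \<longleftrightarrow>
     (\<exists>us ts. set us = univ A \<and> set ts = {(R, as). as \<in> rels A R} \<and>
        v = Node (code_list us) (code_list (map (\<lambda>(R, as). Node R (code_list as)) ts)))"

definition codes_instance ::
    "(data, data) rel_struct \<Rightarrow> (data, data) rel_struct \<Rightarrow> data \<Rightarrow> bool" where
  "codes_instance A B v \<longleftrightarrow>
     (\<exists>v\<^sub>A v\<^sub>B. codes_structure A v\<^sub>A \<and> codes_structure B v\<^sub>B \<and> v = Node v\<^sub>A v\<^sub>B)"

text \<open>The tuples of \<open>B'\<close> are output as a list of the maps they stand for, each map being an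
association list. The domain of a map determines the relation symbol of the tuple. In particular,
the output is \<open>Leaf\<close> iff no tuple is left.\<close>

definition codes_tuples :: "(data set, data) rel_struct \<Rightarrow> data \<Rightarrow> bool" where
  "codes_tuples B' w \<longleftrightarrow>
     (\<exists>ms. map_of ` set ms = {tuple_map U bs | U bs. bs \<in> rels B' U} \<and>
        w = code_list (map (\<lambda>m. code_list (map (\<lambda>(u, b). Node u b) m)) ms))"

end

theory Submission
  imports Defs
begin

text \<open>The bags belong to \<open>C\<close>, whereas the unions that the algorithm knows belong
  to \<open>A\<close>. The two meet because a homomorphism carries each hyperedge onto a hyperedge:
  \<open>k\<close> hyperedges covering a bag become a \<open>k\<close>-union of \<open>A\<close>.
  Support of a map concerns one other map at a time; this is enough for a whole tree because a node
  attached to a connected part has only one neighbour there. Projectivity is weak on a tuple that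
  leaves the domain, but it yields a full tuple of \<open>B\<close> on one that stays inside, and
  every tuple of \<open>C\<close> is sent into the domain of the map chosen for some bag. The
  program deletes in simultaneous rounds, while a run deletes single tuples. Support is monotone in
  the set of remaining maps, so a round can be cut into legal single removals. For the time analysis
  one number \<open>M\<close> bounds all lengths and sizes; each function costs a polynomial in
  \<open>M\<close>, and \<open>M\<close> is a polynomial in the input size.\<close>

text \<open>Identify a tuple \<open>bs \<in> R_U\<close> with the map \<open>listing U \<mapsto> bs\<close>. Then the algorithm starts from the set \<open>H\<close>
of all projective homomorphisms whose domain is a \<open>k\<close>-union and removes any \<open>f \<in> H\<close> for which some \<open>k\<close>-union
is not the domain of a map in \<open>H\<close> that agrees with \<open>f\<close>. Restrictions of a homomorphism are never
removed. Conversely, let \<open>h\<close> map a structure \<open>C\<close> of coverwidth at most \<open>k\<close> to \<open>A\<close>. The image of each bag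
of a tree decomposition (up to isolated vertices) lies in a \<open>k\<close>-union of \<open>A\<close>, and if the final \<open>H\<close> is
nonempty, one can walk along the tree and pick for every bag a map in \<open>H\<close> on this \<open>k\<close>-union that agrees
with the one of the preceding bag. The picked maps composed with \<open>h\<close> glue to a homomorphism from \<open>C\<close> to
\<open>B\<close>; as \<open>A\<close> maps to \<open>C\<close>, the instance is satisfiable.

For the running time, a projective homomorphism on a union of \<open>k\<close> hyperedges sends each of the \<open>k\<close>
tuples of \<open>A\<close> behind it to a tuple of \<open>B\<close> with the same symbol. So the candidates are the \<open>k\<close>-fold
concatenations of such pairings, polynomially many for fixed \<open>k\<close>, and as many simultaneous pruning
rounds as there are candidates reach a fixed point.\<close>

section \<open>The consistency algorithm on sets of partial maps\<close>

lemma listing: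
  assumes "finite U"
  shows distinct_listing: "distinct (listing U)" and set_listing: "set (listing U) = U"
    and length_listing: "length (listing U) = card U"
proof -
  have "\<exists>us. distinct us \<and> set us = U"
    using finite_distinct_list[OF assms] by auto
  then have *: "distinct (listing U) \<and> set (listing U) = U"
    unfolding listing_def by (rule someI_ex)
  then show "distinct (listing U)" "set (listing U) = U" by auto
  with * show "length (listing U) = card U" by (metis distinct_card)
qed

lemma tuple_map_nth:
  assumes "finite U" "length bs = card U" "i < card U"
  shows "tuple_map U bs (listing U ! i) = Some (bs ! i)"
  using assms unfolding tuple_map_def
  by (simp add: map_of_zip_nth listing)

lemma dom_tuple_map:
  assumes "finite U" "length bs = card U"
  shows "dom (tuple_map U bs) = U"
  using assms unfolding tuple_map_def by (simp add: listing)

lemma tuple_map_inj: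
  assumes "finite U" "length bs = card U" "length cs = card U" "tuple_map U bs = tuple_map U cs"
  shows "bs = cs"
proof (rule nth_equalityI)
  fix i assume "i < length bs"
  then show "bs ! i = cs ! i"
    using tuple_map_nth[OF assms(1,2), of i] tuple_map_nth[OF assms(1,3), of i] assms by simp
qed (use assms in simp)

lemma tuple_map_surj:
  assumes "finite U" "dom f = U"
  shows "tuple_map U (map (the \<circ> f) (listing U)) = f"
proof
  fix u
  show "tuple_map U (map (the \<circ> f) (listing U)) u = f u"
  proof (cases "u \<in> U")
    case True
    then have "u \<in> set (listing U)" using assms(1) by (simp add: set_listing)
    then obtain i where "i < length (listing U)" and u: "listing U ! i = u"
      unfolding in_set_conv_nth by blast
    then have i: "i < card U" using assms(1) by (simp add: length_listing)
    then have "tuple_map U (map (the \<circ> f) (listing U)) u = Some (the (f u))"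
      using tuple_map_nth[of U "map (the \<circ> f) (listing U)" i] assms(1) i u by (simp add: length_listing)
    with True assms(2) show ?thesis by auto
  next
    case False
    moreover have "dom (tuple_map U (map (the \<circ> f) (listing U))) = U"
      using assms(1) by (simp add: dom_tuple_map listing)
    ultimately show ?thesis using assms(2) by (metis domIff)
  qed
qed

lemma k_unions_subset: "U \<in> k_unions k E \<Longrightarrow> U \<subseteq> \<Union>E"
  by (auto simp: k_unions_def split: if_splits)

lemma k_unions_nonempty: "k_unions k E \<noteq> {}"
proof (cases "E = {}")
  case False
  then obtain e where "e \<in> E" by blast
  \<comment> \<open>The hyperedges of a union may repeat, so \<open>k\<close> copies of one
    hyperedge do; for \<open>k = 0\<close> this is the empty union.\<close>
  then have "\<Union>(set (replicate k e)) \<in> k_unions k E"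
    unfolding k_unions_def by (auto intro!: exI[of _ "replicate k e"] simp: set_replicate_conv_if)
  then show ?thesis by blast
qed (simp add: k_unions_def)

section \<open>Sets of maps and their support\<close>

locale csp =
  fixes k :: nat and A :: "('s, 'a) rel_struct" and B :: "('s, 'b) rel_struct"
  assumes inst: "csp_instance A B"
begin

abbreviation unions :: "'a set set" where
  "unions \<equiv> k_unions k (hyperedges A)"

definition initial_maps :: "('a \<rightharpoonup> 'b) set" where
  "initial_maps = {f. dom f \<in> unions \<and> projective_homomorphism A B f}"

definition supported :: "('a \<rightharpoonup> 'b) set \<Rightarrow> ('a \<rightharpoonup> 'b) \<Rightarrow> bool" where
  "supported H f \<longleftrightarrow> (\<forall>W \<in> unions. \<exists>g \<in> H. dom g = W \<and> (\<forall>u \<in> dom f \<inter> W. f u = g u))"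

text \<open>The way back from maps to tuples. Filtering the tuples of \<open>union_target\<close>
  keeps its signature, universe and tuple lengths, so that every structure met during a run has the
  form \<open>struct_of H\<close>.\<close>

definition struct_of :: "('a \<rightharpoonup> 'b) set \<Rightarrow> ('a set, 'b) rel_struct" where
  "struct_of H = (union_target k A B)
     \<lparr>rels := (\<lambda>U. {bs \<in> rels (union_target k A B) U. tuple_map U bs \<in> H})\<rparr>"

lemma finite_A: "finite_structure A" and finite_B: "finite_structure B"
  and signat_eq: "signat A = signat B"
  using inst by (auto simp: csp_instance_def)

lemma rels_A: "as \<in> rels A R \<Longrightarrow> signat A R = Some (length as) \<and> set as \<subseteq> univ A"
  using finite_A unfolding finite_structure_def by simp

lemma rels_B: "bs \<in> rels B R \<Longrightarrow> signat A R = Some (length bs) \<and> set bs \<subseteq> univ B"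
  using finite_B unfolding signat_eq finite_structure_def by simp

lemma length_rels: "as \<in> rels A R \<Longrightarrow> bs \<in> rels B R \<Longrightarrow> length as = length bs"
  using rels_A[of as R] rels_B[of bs R] by simp

lemma hyperedges_subset: "\<Union>(hyperedges A) \<subseteq> univ A"
  unfolding hyperedges_def by (auto dest!: rels_A)

lemma unions_subset: "U \<in> unions \<Longrightarrow> U \<subseteq> univ A"
  using subset_trans[OF k_unions_subset hyperedges_subset] .

lemma finite_unions: "finite unions"
proof -
  have "unions \<subseteq> Pow (univ A)" by (intro subsetI PowI unions_subset)
  moreover have "finite (Pow (univ A))" using finite_A by (simp add: finite_structure_def)
  ultimately show ?thesis by (rule finite_subset)
qed

lemma finite_union: "U \<in> unions \<Longrightarrow> finite U"
  using finite_subset[OF unions_subset] finite_A unfolding finite_structure_def by simp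

lemma finite_initial_maps: "finite initial_maps"
proof -
  have "initial_maps \<subseteq> (\<Union>U \<in> unions. {f. dom f = U \<and> ran f \<subseteq> univ B})"
    by (auto simp: initial_maps_def projective_homomorphism_def)
  moreover have "finite \<dots>"
    using finite_unions finite_union finite_B
    by (auto intro!: finite_set_of_finite_maps simp: finite_structure_def)
  ultimately show ?thesis by (rule finite_subset)
qed

text \<open>The entries of \<open>bs\<close> form the range of \<open>tuple_map U bs\<close>, and a
  projective homomorphism has its range in the universe of \<open>B\<close>; this is why the map
  alone decides membership.\<close>

lemma mem_rels_target:
  "bs \<in> rels (union_target k A B) U \<longleftrightarrow>
     U \<in> unions \<and> length bs = card U \<and> tuple_map U bs \<in> initial_maps"
proof -
  have "set bs \<subseteq> univ B" if "U \<in> unions" "length bs = card U"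
    "projective_homomorphism A B (tuple_map U bs)"
  proof -
    have "ran (tuple_map U bs) = set bs"
      unfolding tuple_map_def using that finite_union listing
      by (metis ran_map_of_zip)
    then show ?thesis using that(3) by (auto simp: projective_homomorphism_def)
  qed
  then show ?thesis
    by (auto simp: union_target_def initial_maps_def dom_tuple_map finite_union)
qed

lemma mem_rels_struct_of:
  "H \<subseteq> initial_maps \<Longrightarrow> bs \<in> rels (struct_of H) U \<longleftrightarrow>
     U \<in> unions \<and> length bs = card U \<and> tuple_map U bs \<in> H"
  by (auto simp: struct_of_def mem_rels_target)

lemma tuple_maps_struct_of:
  assumes "H \<subseteq> initial_maps"
  shows "{tuple_map U bs | U bs. bs \<in> rels (struct_of H) U} = H"
proof
  show "H \<subseteq> {tuple_map U bs | U bs. bs \<in> rels (struct_of H) U}"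
  proof
    fix f assume f: "f \<in> H"
    then have d: "dom f \<in> unions" using assms by (auto simp: initial_maps_def)
    let ?bs = "map (the \<circ> f) (listing (dom f))"
    have "tuple_map (dom f) ?bs = f" using d finite_union tuple_map_surj by blast
    moreover from this have "?bs \<in> rels (struct_of H) (dom f)"
      using f d mem_rels_struct_of[OF assms] by (simp add: listing finite_union)
    ultimately show "f \<in> {tuple_map U bs | U bs. bs \<in> rels (struct_of H) U}" by force
  qed
qed (auto simp: mem_rels_struct_of[OF assms])

lemma reports_inconsistency_struct_of:
  "H \<subseteq> initial_maps \<Longrightarrow> reports_inconsistency (struct_of H) \<longleftrightarrow> H = {}"
  using tuple_maps_struct_of[of H] by (auto simp: reports_inconsistency_def)

text \<open>The structure \<open>A'\<close> has exactly one tuple for each union \<open>W\<close>,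
  the listing of \<open>W\<close>. Projectivity therefore asks for one tuple of \<open>R_W\<close>
  that agrees with \<open>f\<close> wherever \<open>f\<close> is defined, and such a tuple is a map
  in \<open>H\<close> with domain \<open>W\<close>.\<close>

lemma projective_iff_supported:
  assumes "H \<subseteq> initial_maps" "f \<in> initial_maps"
  shows "projective_homomorphism (union_source k A) (struct_of H) f \<longleftrightarrow> supported H f"
proof -
  have f: "dom f \<subseteq> univ A" "ran f \<subseteq> univ B"
    using assms(2) by (auto simp: initial_maps_def projective_homomorphism_def)
  have "(\<exists>bs \<in> rels (struct_of H) W. \<forall>i < length (listing W). listing W ! i \<in> dom f \<longrightarrow>
           f (listing W ! i) = Some (bs ! i)) \<longleftrightarrow>
        (\<exists>g \<in> H. dom g = W \<and> (\<forall>u \<in> dom f \<inter> W. f u = g u))" (is "?L = ?R") if W: "W \<in> unions" for W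
  proof
    note fin = finite_union[OF W]
    assume ?L
    then obtain bs where bs: "bs \<in> rels (struct_of H) W"
      and eq: "\<And>i. i < card W \<Longrightarrow> listing W ! i \<in> dom f \<Longrightarrow> f (listing W ! i) = Some (bs ! i)"
      by (auto simp: listing fin)
    have l: "length bs = card W" "tuple_map W bs \<in> H"
      using bs mem_rels_struct_of[OF assms(1)] by auto
    have "f u = tuple_map W bs u" if "u \<in> dom f \<inter> W" for u
    proof -
      have "u \<in> set (listing W)" using that fin by (simp add: set_listing)
      then obtain i where i: "i < length (listing W)" "listing W ! i = u"
        unfolding in_set_conv_nth by blast
      have i': "i < card W" using i(1) fin by (simp add: length_listing)
      have "f u = Some (bs ! i)" using eq[OF i'] that unfolding i(2) by blast
      then show ?thesis using tuple_map_nth[OF fin l(1) i'] unfolding i(2) by simp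
    qed
    then show ?R using l(2) dom_tuple_map[OF fin l(1)]
      by (intro bexI[of _ "tuple_map W bs"] conjI ballI)
  next
    note fin = finite_union[OF W]
    assume ?R
    then obtain g where g: "g \<in> H" "dom g = W" "\<forall>u \<in> dom f \<inter> W. f u = g u"
      by (elim bexE conjE) (rule that)
    have "g \<in> {tuple_map U bs | U bs. bs \<in> rels (struct_of H) U}"
      using g(1) tuple_maps_struct_of[OF assms(1)] by simp
    then obtain U bs where bs: "g = tuple_map U bs" "bs \<in> rels (struct_of H) U" by blast
    then have U: "length bs = card U" "U \<in> unions"
      using mem_rels_struct_of[OF assms(1)] by auto
    have "dom g = U" unfolding bs(1) by (rule dom_tuple_map[OF finite_union[OF U(2)] U(1)])
    then have [simp]: "U = W" using g(2) by simp
    have "f (listing W ! i) = Some (bs ! i)" if "i < card W" "listing W ! i \<in> dom f" for i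
    proof -
      have "listing W ! i \<in> W" using that fin by (metis length_listing nth_mem set_listing)
      then show ?thesis using g(3) that bs(1) U(1) tuple_map_nth[OF fin, of bs i]
        by simp
    qed
    then show ?L using bs(2) by (auto simp: listing fin)
  qed
  then have "supported H f \<longleftrightarrow> (\<forall>W \<in> unions. \<exists>bs \<in> rels (struct_of H) W.
      \<forall>i < length (listing W). listing W ! i \<in> dom f \<longrightarrow> f (listing W ! i) = Some (bs ! i))"
    unfolding supported_def by simp
  moreover have "univ (struct_of H) = univ B" "univ (union_source k A) = univ A"
    "\<And>W. rels (union_source k A) W = (if W \<in> unions then {listing W} else {})"
    by (simp_all add: struct_of_def union_target_def union_source_def)
  moreover have "(\<forall>us \<in> (if W \<in> unions then {listing W} else {}). Q us) \<longleftrightarrow> (W \<in> unions \<longrightarrow> Q (listing W))"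
    for W and Q :: "'a list \<Rightarrow> bool"
    by simp
  ultimately show ?thesis
    using f unfolding projective_homomorphism_def Ball_def[of unions] by simp
qed

section \<open>Runs of the algorithm as removals of single maps\<close>

definition remove_step :: "('a \<rightharpoonup> 'b) set \<Rightarrow> ('a \<rightharpoonup> 'b) set \<Rightarrow> bool" where
  "remove_step H H' \<longleftrightarrow> (\<exists>f \<in> H. \<not> supported H f \<and> H' = H - {f})"

text \<open>One tuple corresponds to one map: inside a relation because \<open>tuple_map U\<close>
  is injective, across relations because different unions give maps with different domains.\<close>

lemma struct_of_delete:
  assumes "H \<subseteq> initial_maps" "bs \<in> rels (struct_of H) U"
  shows "(struct_of H)\<lparr>rels := (rels (struct_of H))(U := rels (struct_of H) U - {bs})\<rparr> =
         struct_of (H - {tuple_map U bs})"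
proof -
  have bs: "U \<in> unions" "length bs = card U" using assms mem_rels_struct_of by blast+
  have "((rels (struct_of H))(U := rels (struct_of H) U - {bs})) W =
        rels (struct_of (H - {tuple_map U bs})) W" for W
  proof (cases "W = U")
    case True
    have "H - {tuple_map U bs} \<subseteq> initial_maps" using assms by blast
    then show ?thesis using True bs assms(1) tuple_map_inj[OF finite_union[OF bs(1)], of _ bs]
      by (auto simp: mem_rels_struct_of)
  next
    case False
    have "H - {tuple_map U bs} \<subseteq> initial_maps" using assms by blast
    moreover have "tuple_map W cs \<noteq> tuple_map U bs" if "W \<in> unions" "length cs = card W" for cs
      using False that bs dom_tuple_map finite_union by metis
    ultimately show ?thesis using False assms(1) by (auto simp: mem_rels_struct_of)
  qed
  then have "(rels (struct_of H))(U := rels (struct_of H) U - {bs}) =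
        rels (struct_of (H - {tuple_map U bs}))" by blast
  then show ?thesis by (simp add: struct_of_def)
qed

lemma prune_step_struct_of:
  assumes "H \<subseteq> initial_maps"
  shows "prune_step (union_source k A) (struct_of H) B\<^sub>2 \<longleftrightarrow>
         (\<exists>H'. remove_step H H' \<and> B\<^sub>2 = struct_of H')"
proof
  assume "prune_step (union_source k A) (struct_of H) B\<^sub>2"
  then obtain U bs where bs: "bs \<in> rels (struct_of H) U"
    "\<not> projective_homomorphism (union_source k A) (struct_of H) (tuple_map U bs)"
    "B\<^sub>2 = struct_of (H - {tuple_map U bs})"
    unfolding prune_step_def using struct_of_delete[OF assms] by metis
  moreover have "tuple_map U bs \<in> H" using bs(1) mem_rels_struct_of[OF assms] by blast
  ultimately show "\<exists>H'. remove_step H H' \<and> B\<^sub>2 = struct_of H'"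
    using projective_iff_supported assms unfolding remove_step_def by blast
next
  assume "\<exists>H'. remove_step H H' \<and> B\<^sub>2 = struct_of H'"
  then obtain f where f: "f \<in> H" "\<not> supported H f" "B\<^sub>2 = struct_of (H - {f})"
    unfolding remove_step_def by blast
  have "f \<in> {tuple_map U bs | U bs. bs \<in> rels (struct_of H) U}"
    using f(1) tuple_maps_struct_of[OF assms] by simp
  then obtain U bs where bs: "f = tuple_map U bs" "bs \<in> rels (struct_of H) U" by blast
  have "\<not> projective_homomorphism (union_source k A) (struct_of H) (tuple_map U bs)"
    using f projective_iff_supported[OF assms] assms unfolding bs(1)[symmetric] by auto
  then show "prune_step (union_source k A) (struct_of H) B\<^sub>2"
    unfolding prune_step_def f(3) bs(1) struct_of_delete[OF assms bs(2), symmetric]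
    using bs(2) by blast
qed

lemma struct_of_initial_maps: "struct_of initial_maps = union_target k A B"
proof -
  have "rels (union_target k A B) U = {bs \<in> rels (union_target k A B) U. tuple_map U bs \<in> initial_maps}" for U
    by (auto simp: mem_rels_target)
  then have "(\<lambda>U. {bs \<in> rels (union_target k A B) U. tuple_map U bs \<in> initial_maps}) = rels (union_target k A B)"
    by blast
  then show ?thesis by (simp add: struct_of_def)
qed

lemma remove_steps_subset: "remove_step\<^sup>*\<^sup>* H H' \<Longrightarrow> H' \<subseteq> H"
  by (induction rule: rtranclp_induct) (auto simp: remove_step_def)

text \<open>Pruning steps and single removals simulate each other through \<open>struct_of\<close>
  (facts 1 and 2), and no pruning step is left exactly when all remaining maps are supported (fact
  3).\<close>

lemma pkc_result_iff:
  "pkc_result k A B B' \<longleftrightarrow>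
     (\<exists>H. B' = struct_of H \<and> remove_step\<^sup>*\<^sup>* initial_maps H \<and> (\<forall>f \<in> H. supported H f))"
proof -
  have 1: "\<exists>H. B' = struct_of H \<and> remove_step\<^sup>*\<^sup>* initial_maps H"
    if "(prune_step (union_source k A))\<^sup>*\<^sup>* (union_target k A B) B'" for B'
    using that
  proof (induction rule: rtranclp_induct)
    case base
    show ?case using struct_of_initial_maps by (metis rtranclp.rtrancl_refl)
  next
    case (step B\<^sub>1 B\<^sub>2)
    then obtain H where H: "B\<^sub>1 = struct_of H" "remove_step\<^sup>*\<^sup>* initial_maps H" by blast
    have "\<exists>H'. remove_step H H' \<and> B\<^sub>2 = struct_of H'"
      using step(2) unfolding H(1) prune_step_struct_of[OF remove_steps_subset[OF H(2)]] .
    then obtain H' where "remove_step H H'" "B\<^sub>2 = struct_of H'" by metis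
    then show ?case using rtranclp.rtrancl_into_rtrancl[OF H(2)] by blast
  qed
  have 2: "(prune_step (union_source k A))\<^sup>*\<^sup>* (union_target k A B) (struct_of H)"
    if "remove_step\<^sup>*\<^sup>* initial_maps H" for H
    using that
  proof (induction rule: rtranclp_induct)
    case base
    then show ?case by (simp add: struct_of_initial_maps)
  next
    case (step H H')
    then have "prune_step (union_source k A) (struct_of H) (struct_of H')"
      unfolding prune_step_struct_of[OF remove_steps_subset[OF step(1)]] by metis
    then show ?case using step(3) by (meson rtranclp.rtrancl_into_rtrancl)
  qed
  have 3: "(\<nexists>B''. prune_step (union_source k A) (struct_of H) B'') \<longleftrightarrow> (\<forall>f \<in> H. supported H f)"
    if "remove_step\<^sup>*\<^sup>* initial_maps H" for H
    unfolding prune_step_struct_of[OF remove_steps_subset[OF that]] remove_step_def by metis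
  show ?thesis
  proof
    assume B': "pkc_result k A B B'"
    then obtain H where H: "B' = struct_of H" "remove_step\<^sup>*\<^sup>* initial_maps H"
      using 1[of B'] unfolding pkc_result_def by auto
    moreover have "\<forall>f \<in> H. supported H f"
      using B' 3[OF H(2)] unfolding pkc_result_def H(1) by simp
    ultimately show "\<exists>H. B' = struct_of H \<and> remove_step\<^sup>*\<^sup>* initial_maps H \<and> (\<forall>f \<in> H. supported H f)"
      by auto
  next
    assume "\<exists>H. B' = struct_of H \<and> remove_step\<^sup>*\<^sup>* initial_maps H \<and> (\<forall>f \<in> H. supported H f)"
    then obtain H where "B' = struct_of H" "remove_step\<^sup>*\<^sup>* initial_maps H" "\<forall>f \<in> H. supported H f"
      by auto
    then show "pkc_result k A B B'" unfolding pkc_result_def using 2 3 by simp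
  qed
qed

lemma supported_mono: "supported H f \<Longrightarrow> H \<subseteq> H' \<Longrightarrow> supported H' f"
  unfolding supported_def by (meson subsetD)

text \<open>By monotonicity a map that is unsupported in \<open>H\<close> stays so in every subset
  of \<open>H\<close>. The maps deleted in a simultaneous round can thus be removed one after
  another.\<close>

lemma remove_unsupported:
  assumes "finite H"
  shows "remove_step\<^sup>*\<^sup>* H {f \<in> H. supported H f}"
proof -
  have *: "remove_step\<^sup>*\<^sup>* H (H - D)" if "finite D" "D \<subseteq> {f \<in> H. \<not> supported H f}" for D
    using that
  proof (induction D)
    case (insert f D)
    have "f \<in> H - D" "\<not> supported H f" using insert.prems insert.hyps(2) by auto
    moreover have "\<not> supported (H - D) f"
      using \<open>\<not> supported H f\<close> supported_mono[of "H - D" f H] by auto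
    moreover have "H - insert f D = H - D - {f}" by (rule Diff_insert)
    ultimately have "remove_step (H - D) (H - insert f D)" unfolding remove_step_def by metis
    moreover have "remove_step\<^sup>*\<^sup>* H (H - D)" using insert.IH insert.prems by simp
    ultimately show ?case by (metis rtranclp.rtrancl_into_rtrancl)
  qed simp
  have "H - {f \<in> H. \<not> supported H f} = {f \<in> H. supported H f}" by blast
  moreover have "finite {f \<in> H. \<not> supported H f}" using assms by simp
  note *[OF this order_refl]
  ultimately show ?thesis by (simp only:)
qed

lemma pkc_result_exists: "\<exists>B'. pkc_result k A B B'"
proof -
  have "\<exists>H'. remove_step\<^sup>*\<^sup>* H H' \<and> (\<forall>f \<in> H'. supported H' f)" if "finite H" for H
    using that
  proof (induction H rule: finite_psubset_induct)
    case (psubset H)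
    show ?case
    proof (cases "\<forall>f \<in> H. supported H f")
      case False
      then obtain f where f: "f \<in> H" "\<not> supported H f" by blast
      then obtain H' where "remove_step\<^sup>*\<^sup>* (H - {f}) H'" "\<forall>f \<in> H'. supported H' f"
        using psubset by blast
      moreover have "remove_step H (H - {f})" using f unfolding remove_step_def by blast
      ultimately show ?thesis by (meson converse_rtranclp_into_rtranclp)
    qed blast
  qed
  then show ?thesis using pkc_result_iff finite_initial_maps by blast
qed

text \<open>Any two restrictions of the same map agree on their common domain, so the restrictions
  of a homomorphism to the unions support one another and none of them can be the first to
  go.\<close>

lemma satisfiable_nonempty:
  assumes "satisfiable A B" "remove_step\<^sup>*\<^sup>* initial_maps H"
  shows "H \<noteq> {}"
proof -
  obtain h where h: "homomorphism A B h" using assms(1) unfolding satisfiable_def by blast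
  define r where "r U = (\<lambda>u. if u \<in> U then Some (h u) else None)" for U
  have dom_r: "dom (r U) = U" for U by (auto simp: r_def dom_def)
  have init: "r U \<in> initial_maps" if U: "U \<in> unions" for U
  proof -
    have "ran (r U) \<subseteq> univ B"
      using h unions_subset[OF U] by (auto simp: r_def ran_def homomorphism_def split: if_splits)
    moreover have "\<exists>bs \<in> rels B R. \<forall>i < length as. as ! i \<in> dom (r U) \<longrightarrow> r U (as ! i) = Some (bs ! i)"
      if "as \<in> rels A R" for R as
      using h that unfolding homomorphism_def
      by (intro bexI[of _ "map h as"]) (auto simp: dom_r, auto simp: r_def)
    ultimately show ?thesis
      using U unions_subset[OF U] by (auto simp: initial_maps_def projective_homomorphism_def dom_r)
  qed
  have "r ` unions \<subseteq> H" using assms(2)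
  proof (induction rule: rtranclp_induct)
    case base
    then show ?case using init by blast
  next
    case (step H H')
    have "supported H (r U)" for U
      unfolding supported_def
    proof
      fix W assume "W \<in> unions"
      then show "\<exists>g\<in>H. dom g = W \<and> (\<forall>u\<in>dom (r U) \<inter> W. r U u = g u)"
        using step by (intro bexI[of _ "r W"]) (auto simp: dom_r, auto simp: r_def)
    qed
    then show ?case using step unfolding remove_step_def by blast
  qed
  then show ?thesis using k_unions_nonempty by fastforce
qed

end

section \<open>Soundness along a tree decomposition\<close>

text \<open>When the walk returns to a visited node, the path is cut back to that node. The bound by
  \<open>Range R\<close> is meant for relations restricted to a set: it keeps the path inside the
  set.\<close>

lemma distinct_path:
  assumes "(x, y) \<in> R\<^sup>*"
  shows "\<exists>cs. cs \<noteq> [] \<and> distinct cs \<and> hd cs = x \<and> last cs = y \<and>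
    set cs \<subseteq> insert x (Range R) \<and> successively (\<lambda>s t. (s, t) \<in> R) cs"
  using assms
proof (induction rule: rtrancl_induct)
  case base
  show ?case by (intro exI[of _ "[x]"]) simp
next
  case (step y z)
  then obtain cs where cs: "cs \<noteq> []" "distinct cs" "hd cs = x" "last cs = y"
    "set cs \<subseteq> insert x (Range R)" "successively (\<lambda>s t. (s, t) \<in> R) cs"
    by (elim exE conjE)
  show ?case
  proof (cases "z \<in> set cs")
    case True
    then obtain us vs where "cs = us @ z # vs" by (meson split_list)
    then show ?thesis using cs
      by (intro exI[of _ "us @ [z]"]) (auto simp: successively_append_iff successively_Cons hd_append split: if_splits)
  next
    case False
    have "z \<in> Range R" using step.hyps(2) by (rule RangeI)
    then show ?thesis using cs False step.hyps(2)
      by (intro exI[of _ "cs @ [z]"]) (auto simp: successively_append_iff)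
  qed
qed

lemma leaving_edge:
  assumes "(s, t) \<in> R\<^sup>*" "s \<in> S" "t \<notin> S"
  shows "\<exists>x y. (x, y) \<in> R \<and> x \<in> S \<and> y \<notin> S"
  using assms
  by (induction rule: rtrancl_induct) metis+

text \<open>A path inside \<open>S\<close> from \<open>s\<close> to \<open>s'\<close> would close
  through \<open>t\<close> to a cycle; it has at least three nodes because \<open>s\<close>,
  \<open>s'\<close> and \<open>t\<close> are distinct.\<close>

lemma unique_neighbour:
  assumes "sym F" "\<not> has_cycle F" "connected_in F S" "t \<notin> S"
    and "s \<in> S" "(s, t) \<in> F" "s' \<in> S" "(s', t) \<in> F"
  shows "s = s'"
proof (rule ccontr)
  assume "s \<noteq> s'"
  have "(s, s') \<in> (F \<inter> S \<times> S)\<^sup>*" using assms by (simp add: connected_in_def)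
  from distinct_path[OF this] obtain cs where cs: "cs \<noteq> []" "distinct cs" "hd cs = s" "last cs = s'"
    "set cs \<subseteq> insert s (Range (F \<inter> S \<times> S))" "successively (\<lambda>s t. (s, t) \<in> F \<inter> S \<times> S) cs"
    by (elim exE conjE)
  have "set cs \<subseteq> S" using cs(5) assms(5) by auto
  then have "t \<notin> set cs" using assms(4) by auto
  have "successively (\<lambda>s t. (s, t) \<in> F) cs"
    using cs(6) by (rule successively_mono) simp
  then have 1: "successively (\<lambda>s t. (s, t) \<in> F) (cs @ [t])"
    using assms(8) cs(1,4) by (simp add: successively_append_iff)
  have "length cs \<noteq> 1" using \<open>s \<noteq> s'\<close> cs(3,4) by (auto simp: length_Suc_conv)
  moreover have "length cs \<noteq> 0" using cs(1) by simp
  ultimately have "length cs \<ge> 2" by linarith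
  then have 2: "length (cs @ [t]) \<ge> 3" by simp
  have 3: "distinct (cs @ [t])" using \<open>t \<notin> set cs\<close> cs(2) by simp
  have 4: "(last (cs @ [t]), hd (cs @ [t])) \<in> F"
    using assms(1,6) cs(1,3) by (simp add: symD)
  show False using assms(2) 1 2 3 4 unfolding has_cycle_def by blast
qed

lemma connected_in_insert:
  assumes "sym F" "connected_in F S" "s \<in> S" "(s, t) \<in> F"
  shows "connected_in F (insert t S)"
proof -
  let ?R = "F \<inter> insert t S \<times> insert t S"
  have mono: "(F \<inter> S \<times> S)\<^sup>* \<subseteq> ?R\<^sup>*" by (rule rtrancl_mono) auto
  have sym: "sym (?R\<^sup>*)" using assms(1) by (intro sym_rtrancl) (auto simp: sym_def)
  have "(x, s) \<in> ?R\<^sup>*" if "x \<in> insert t S" for x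
  proof (cases "x = t")
    case True
    then have "(x, s) \<in> ?R" using assms by (simp add: symD)
    then show ?thesis by (rule r_into_rtrancl)
  next
    case False
    then have "(x, s) \<in> (F \<inter> S \<times> S)\<^sup>*" using that assms by (simp add: connected_in_def)
    then show ?thesis using mono by (rule subsetD[rotated])
  qed
  then show ?thesis unfolding connected_in_def
    using sym by (meson rtrancl_trans symD)
qed

text \<open>Take a maximal connected set of nodes that admits a compatible choice. If it missed a
  node, some edge would lead out of it to a node \<open>t\<close>. By
  \<open>unique_neighbour\<close> this is the only connection of \<open>t\<close> to the set, so
  \<open>extend\<close> meets all new constraints at once. \<open>Q_sym\<close> serves the reverse
  orientation of that edge.\<close>

lemma tree_choice:
  assumes tree: "is_tree N F"
    and start: "\<And>t. t \<in> N \<Longrightarrow> \<exists>x. P t x"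
    and extend: "\<And>s t x. (s, t) \<in> F \<Longrightarrow> P s x \<Longrightarrow> \<exists>y. P t y \<and> Q s t x y"
    and Q_sym: "\<And>s t x y. Q s t x y \<Longrightarrow> Q t s y x"
  shows "\<exists>c. (\<forall>t \<in> N. P t (c t)) \<and> (\<forall>(s, t) \<in> F. Q s t (c s) (c t))"
proof -
  have fin: "finite N" and ne: "N \<noteq> {}" and FN: "F \<subseteq> N \<times> N" and sym: "sym F" and irr: "irrefl F"
    and conn: "connected_in F N" and acyclic: "\<not> has_cycle F"
    using tree by (simp_all add: is_tree_def)
  define ok where "ok S \<longleftrightarrow> S \<subseteq> N \<and> S \<noteq> {} \<and> connected_in F S \<and>
    (\<exists>c. (\<forall>t \<in> S. P t (c t)) \<and> (\<forall>(s, t) \<in> F \<inter> S \<times> S. Q s t (c s) (c t)))" for S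
  obtain r where r: "r \<in> N" using ne by auto
  obtain x where x: "P r x" using start r by metis
  \<comment> \<open>By irreflexivity no edge runs inside a singleton, so \<open>Q\<close> asks for
    nothing yet.\<close>
  have "ok {r}" unfolding ok_def
    using r x irr by (auto simp: connected_in_def irrefl_def intro!: exI[of _ "\<lambda>_. x"])
  moreover have "finite {S. ok S}"
    by (rule finite_subset[of _ "Pow N"]) (use fin in \<open>auto simp: ok_def\<close>)
  ultimately obtain S where S: "ok S" and max: "\<And>T. ok T \<Longrightarrow> S \<subseteq> T \<Longrightarrow> S = T"
    using finite_has_maximal[of "{S. ok S}"] by auto
  have SN: "S \<subseteq> N" "S \<noteq> {}" "connected_in F S" using S by (simp_all add: ok_def)
  obtain c where cS: "\<forall>t \<in> S. P t (c t)" "\<forall>(s, t) \<in> F \<inter> S \<times> S. Q s t (c s) (c t)"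
    using S unfolding ok_def by (elim conjE exE) (rule that)
  have c: "\<And>t. t \<in> S \<Longrightarrow> P t (c t)"
    "\<And>s t. (s, t) \<in> F \<Longrightarrow> s \<in> S \<Longrightarrow> t \<in> S \<Longrightarrow> Q s t (c s) (c t)"
    using cS by auto
  have "S = N"
  proof (rule ccontr)
    assume "S \<noteq> N"
    then obtain s0 t0 where "s0 \<in> S" "t0 \<in> N" "t0 \<notin> S" using SN by auto
    moreover from this have "(s0, t0) \<in> (F \<inter> N \<times> N)\<^sup>*"
      using conn SN(1) unfolding connected_in_def by auto
    ultimately obtain s t where st: "(s, t) \<in> F" "s \<in> S" "t \<notin> S" "t \<in> N"
      using leaving_edge[of s0 t0 "F \<inter> N \<times> N" S] by auto
    obtain y where y: "P t y" "Q s t (c s) y" using extend[OF st(1) c(1)[OF st(2)]] by auto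
    have uniq: "s' = s" if "s' \<in> S" "(s', t) \<in> F" for s'
      using unique_neighbour[OF sym acyclic SN(3) st(3) that st(2,1)] .
    have uniq': "s' = s" if "s' \<in> S" "(t, s') \<in> F" for s'
      using uniq[OF that(1)] that(2) sym by (simp add: symD)
    define c' where "c' = c(t := y)"
    have "Q p q (c' p) (c' q)" if pq: "(p, q) \<in> F" "p \<in> insert t S" "q \<in> insert t S" for p q
    proof -
      have "p \<noteq> q" using pq irr by (auto simp: irrefl_def)
      then consider "p = t" "q \<in> S" | "q = t" "p \<in> S" | "p \<in> S" "q \<in> S" using pq by auto
      then show ?thesis
      proof cases
        case 1
        then have "q = s" using uniq' pq(1) by simp
        then show ?thesis using Q_sym[OF y(2)] 1 st by (auto simp: c'_def)
      next
        case 2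
        then have "p = s" using uniq pq(1) by simp
        then show ?thesis using y(2) 2 st by (auto simp: c'_def)
      next
        case 3
        then show ?thesis using c(2)[OF pq(1)] st(3) by (auto simp: c'_def)
      qed
    qed
    moreover have "\<forall>p \<in> insert t S. P p (c' p)" using c(1) y(1) by (auto simp: c'_def)
    ultimately have "\<exists>c. (\<forall>t \<in> insert t S. P t (c t)) \<and>
        (\<forall>(p, q) \<in> F \<inter> insert t S \<times> insert t S. Q p q (c p) (c q))"
      by (intro exI[of _ c']) auto
    then have "ok (insert t S)" unfolding ok_def
      using connected_in_insert[OF sym SN(3) st(2,1)] SN(1) st(4) by simp
    then show False using max[of "insert t S"] st(3) by auto
  qed
  then show ?thesis using c FN by (intro exI[of _ c]) auto
qed

section \<open>Unions, weight and coverwidth\<close>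

text \<open>The list of hyperedges is padded with an arbitrary hyperedge, which may enlarge the
  union; hence an inclusion.\<close>

lemma k_unions_mono:
  assumes "i \<le> j" "U \<in> k_unions i E"
  shows "\<exists>V \<in> k_unions j E. U \<subseteq> V"
proof (cases "E = {}")
  case True
  then show ?thesis using assms by (auto simp: k_unions_def)
next
  case False
  then obtain e where e: "e \<in> E" by auto
  from False assms(2) obtain es where es: "U = \<Union>(set es)" "length es = i" "set es \<subseteq> E"
    by (auto simp: k_unions_def)
  let ?es = "es @ replicate (j - i) e"
  have "length ?es = j" "set ?es \<subseteq> E" "U \<subseteq> \<Union>(set ?es)"
    using assms(1) e es by (auto simp: set_replicate_conv_if)
  moreover from this have "\<Union>(set ?es) \<in> k_unions j E"
    unfolding k_unions_def using False by (auto simp del: set_append intro!: exI[of _ ?es])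
  ultimately show ?thesis by (intro bexI)
qed

text \<open>The least number in \<open>weight\<close> is attained, since the union of all finitely
  many hyperedges covers everything; padding then leads from the weight to \<open>k\<close>.\<close>

lemma weight_le:
  assumes "finite E" "weight E X \<le> k"
  shows "\<exists>U \<in> k_unions k E. X \<inter> \<Union>E \<subseteq> U"
proof -
  obtain es where es: "set es = E" using finite_list[OF assms(1)] by auto
  have "\<exists>U \<in> k_unions (length es) E. X \<inter> \<Union>E \<subseteq> U"
  proof (cases "E = {}")
    case False
    then have "\<Union>E \<in> k_unions (length es) E" using es by (auto simp: k_unions_def)
    then show ?thesis by auto
  qed (simp add: k_unions_def)
  then have "\<exists>U \<in> k_unions (weight E X) E. X \<inter> \<Union>E \<subseteq> U" unfolding weight_def by (rule LeastI)
  then obtain U where U: "U \<in> k_unions (weight E X) E" "X \<inter> \<Union>E \<subseteq> U" by auto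
  then show ?thesis using k_unions_mono[OF assms(2) U(1)] by auto
qed

lemma finite_hyperedges:
  assumes "finite_structure C"
  shows "finite (hyperedges C)" and "\<Union>(hyperedges C) \<subseteq> univ C"
proof -
  have "hyperedges C \<subseteq> Pow (univ C)"
    using assms by (auto simp: finite_structure_def hyperedges_def)
  moreover have "finite (Pow (univ C))" using assms by (simp add: finite_structure_def)
  ultimately show "finite (hyperedges C)" "\<Union>(hyperedges C) \<subseteq> univ C"
    by (auto intro: finite_subset)
qed

text \<open>The tree with a single node and the whole universe as its bag is a decomposition, so the
  minimum in \<open>coverwidth\<close> is attained.\<close>

lemma coverwidth_decomposition:
  assumes "finite_structure C" "coverwidth C \<le> k"
  obtains N :: "nat set" and F X where
    "tree_decomposition (univ C) (hyperedges C) N F X"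
    "\<And>t. t \<in> N \<Longrightarrow> weight (hyperedges C) (X t) \<le> k"
proof -
  let ?E = "hyperedges C"
  define Q where "Q w \<longleftrightarrow> (\<exists>(N :: nat set) F X. tree_decomposition (univ C) ?E N F X \<and>
    decomposition_weight ?E N X = w)" for w
  have "is_tree {0 :: nat} {}"
    by (auto simp: is_tree_def connected_in_def has_cycle_def sym_def irrefl_def)
  then have "tree_decomposition (univ C) ?E {0 :: nat} {} (\<lambda>_. univ C)"
    using finite_hyperedges(2)[OF assms(1)] by (auto simp: tree_decomposition_def connected_in_def)
  then have "Q (decomposition_weight ?E {0 :: nat} (\<lambda>_. univ C))" unfolding Q_def by blast
  then have "Q (LEAST w. Q w)" by (rule LeastI)
  moreover have "coverwidth C = (LEAST w. Q w)" unfolding coverwidth_def Q_def ..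
  ultimately obtain N :: "nat set" and F X where
    NFX: "tree_decomposition (univ C) ?E N F X" "decomposition_weight ?E N X \<le> k"
    using assms(2) unfolding Q_def by metis
  moreover have "finite N" using NFX(1) by (simp add: tree_decomposition_def is_tree_def)
  then have "weight ?E (X t) \<le> k" if "t \<in> N" for t
    using NFX(2) that unfolding decomposition_weight_def
    by (metis Max_ge finite_imageI imageI le_trans)
  ultimately show ?thesis by (intro that)
qed

section \<open>Gluing the maps chosen for the bags\<close>

context csp
begin

lemma decomposition_homomorphism:
  assumes H: "H \<subseteq> initial_maps" "H \<noteq> {}" "\<And>f. f \<in> H \<Longrightarrow> supported H f"
    and C: "finite_structure C" and h: "homomorphism C A h"
    and dec: "tree_decomposition (univ C) (hyperedges C) N F X"
    and weights: "\<And>t. t \<in> N \<Longrightarrow> weight (hyperedges C) (X t) \<le> k"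
  shows "satisfiable C B"
proof -
  let ?E = "hyperedges C"
  have image: "h ` e \<in> hyperedges A" if e: "e \<in> ?E" for e
  proof -
    obtain R vs where "e = set vs" "vs \<in> rels C R" using e by (auto simp: hyperedges_def)
    then have "h ` e = set (map h vs)" "map h vs \<in> rels A R"
      using h by (simp_all add: homomorphism_def)
    then show ?thesis unfolding hyperedges_def by (metis (mono_tags, lifting) mem_Collect_eq)
  qed
  \<comment> \<open>The images of the \<open>k\<close> hyperedges covering the bag are again
    \<open>k\<close> hyperedges, now of \<open>A\<close>.\<close>
  have "\<exists>U \<in> unions. h ` (X t \<inter> \<Union>?E) \<subseteq> U" if t: "t \<in> N" for t
  proof (cases "?E = {}")
    case True
    then show ?thesis using k_unions_nonempty[of k "hyperedges A"] by auto
  next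
    case False
    obtain es where es: "length es = k" "set es \<subseteq> ?E" "X t \<inter> \<Union>?E \<subseteq> \<Union>(set es)"
      using weight_le[OF finite_hyperedges(1)[OF C] weights[OF t]] False
      by (auto simp: k_unions_def)
    have "hyperedges A \<noteq> {}" using False image by auto
    moreover have "set (map ((`) h) es) \<subseteq> hyperedges A" using es(2) image by auto
    ultimately have "\<Union>(set (map ((`) h) es)) \<in> unions"
      using es(1) unfolding k_unions_def by (simp del: set_map) (metis length_map)
    moreover have "h ` (X t \<inter> \<Union>?E) \<subseteq> \<Union>(set (map ((`) h) es))" using es(3) by auto
    ultimately show ?thesis by (rule bexI[rotated])
  qed
  then obtain U where U: "\<And>t. t \<in> N \<Longrightarrow> U t \<in> unions"
    "\<And>t. t \<in> N \<Longrightarrow> h ` (X t \<inter> \<Union>?E) \<subseteq> U t" by metis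
  have tree: "is_tree N F" and FN: "F \<subseteq> N \<times> N" and cover: "(\<Union>t \<in> N. X t) = univ C"
    and edges: "\<And>e. e \<in> ?E \<Longrightarrow> \<exists>t \<in> N. e \<subseteq> X t"
    and conn: "\<And>v. v \<in> univ C \<Longrightarrow> connected_in F {t \<in> N. v \<in> X t}"
    using dec by (simp_all add: tree_decomposition_def is_tree_def)
  have ext: "\<exists>g. (g \<in> H \<and> dom g = W) \<and> (\<forall>u \<in> dom f \<inter> W. f u = g u)"
    if "f \<in> H" "W \<in> unions" for f W
    using H(3)[OF that(1)] that(2) unfolding supported_def by metis
  have "\<exists>c. (\<forall>t \<in> N. c t \<in> H \<and> dom (c t) = U t) \<and>
      (\<forall>(s, t) \<in> F. \<forall>u \<in> U s \<inter> U t. c s u = c t u)"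
  proof (rule tree_choice[OF tree])
    show "\<exists>f. f \<in> H \<and> dom f = U t" if "t \<in> N" for t
      using H(2) ext[OF _ U(1)[OF that]] by (metis all_not_in_conv)
    show "\<exists>g. (g \<in> H \<and> dom g = U t) \<and> (\<forall>u \<in> U s \<inter> U t. f u = g u)"
      if "(s, t) \<in> F" "f \<in> H \<and> dom f = U s" for s t f
      using ext[of f "U t"] U(1)[of t] that FN by auto
  qed auto
  then obtain c where cN: "\<forall>t \<in> N. c t \<in> H \<and> dom (c t) = U t"
    "\<forall>(s, t) \<in> F. \<forall>u \<in> U s \<inter> U t. c s u = c t u" by (elim exE conjE) (rule that)
  have c: "\<And>t. t \<in> N \<Longrightarrow> c t \<in> H" "\<And>t. t \<in> N \<Longrightarrow> dom (c t) = U t"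
    "\<And>s t u. (s, t) \<in> F \<Longrightarrow> u \<in> U s \<Longrightarrow> u \<in> U t \<Longrightarrow> c s u = c t u" using cN by auto
  \<comment> \<open>The choice ensures agreement along edges only. The bags containing
    \<open>v\<close> are connected, and \<open>h v\<close> lies in the union of each of them, so the
    agreement propagates.\<close>
  have c_eq: "c s (h v) = c t (h v)"
    if "v \<in> \<Union>?E" "s \<in> N" "v \<in> X s" "t \<in> N" "v \<in> X t" for v s t
  proof -
    let ?S = "{t \<in> N. v \<in> X t}"
    have "v \<in> univ C" using that finite_hyperedges(2)[OF C] by auto
    then have "(s, t) \<in> (F \<inter> ?S \<times> ?S)\<^sup>*"
      using conn[of v] that unfolding connected_in_def by auto
    then show ?thesis
    proof (induction rule: rtrancl_induct)
      case (step t t')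
      then have "h v \<in> U t" "h v \<in> U t'" using U(2) that(1) by auto
      then show ?case using c(3)[of t t' "h v"] step by auto
    qed simp
  qed
  \<comment> \<open>The unions need not cover vertices outside all hyperedges. No tuple mentions
    these, so a fixed element of \<open>B\<close> can be their value.\<close>
  obtain b where b: "b \<in> univ B" using finite_B by (auto simp: finite_structure_def)
  define bag where "bag v = (SOME t. t \<in> N \<and> v \<in> X t)" for v
  define p where "p v = (if v \<in> \<Union>?E then the (c (bag v) (h v)) else b)" for v
  have p: "c t (h v) = Some (p v)" if "v \<in> \<Union>?E" "t \<in> N" "v \<in> X t" for v t
  proof -
    have "bag v \<in> N \<and> v \<in> X (bag v)" unfolding bag_def by (rule someI[of _ t]) (use that in simp)
    then have "c t (h v) = c (bag v) (h v)" using c_eq that by metis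
    moreover have "p v = the (c (bag v) (h v))" using that(1) by (simp only: p_def if_True)
    moreover have "h v \<in> dom (c t)" using U(2)[OF that(2)] c(2)[OF that(2)] that by auto
    then have "c t (h v) = Some (the (c t (h v)))" by auto
    ultimately show ?thesis by simp
  qed
  have "p v \<in> univ B" if "v \<in> univ C" for v
  proof (cases "v \<in> \<Union>?E")
    case True
    obtain t where t: "t \<in> N" "v \<in> X t" using cover \<open>v \<in> univ C\<close> by auto
    have "ran (c t) \<subseteq> univ B"
      using c(1)[OF t(1)] H(1) by (auto simp: initial_maps_def projective_homomorphism_def)
    then show ?thesis using p[OF True t] by (auto simp: ran_def)
  qed (simp add: p_def b)
  moreover have "map p vs \<in> rels B R" if vs: "vs \<in> rels C R" for vs R
  proof -
    have e: "set vs \<in> ?E" using vs by (auto simp: hyperedges_def)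
    then obtain t where t: "t \<in> N" "set vs \<subseteq> X t" using edges by auto
    have hvs: "map h vs \<in> rels A R" using vs h by (simp add: homomorphism_def)
    have pv: "c t (h v) = Some (p v)" if "v \<in> set vs" for v using p[of v t] that e t by auto
    have "projective_homomorphism A B (c t)"
      using c(1)[OF t(1)] H(1) by (auto simp: initial_maps_def)
    then obtain bs where bs: "bs \<in> rels B R"
      "\<And>i. i < length (map h vs) \<Longrightarrow> map h vs ! i \<in> dom (c t) \<Longrightarrow> c t (map h vs ! i) = Some (bs ! i)"
      using hvs unfolding projective_homomorphism_def by metis
    \<comment> \<open>All entries of \<open>map h vs\<close> lie in the domain of
      \<open>c t\<close>, so projectivity determines \<open>bs\<close> at every position.\<close>
    have "map p vs = bs"
    proof (rule nth_equalityI)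
      show "length (map p vs) = length bs" using length_rels[OF hvs bs(1)] by simp
      fix i assume i: "i < length (map p vs)"
      then show "map p vs ! i = bs ! i" using bs(2)[of i] pv[of "vs ! i"] by auto
    qed
    then show ?thesis using bs(1) by simp
  qed
  ultimately have "homomorphism C B p" by (auto simp: homomorphism_def)
  then show ?thesis by (auto simp: satisfiable_def)
qed

end

lemma homomorphism_comp:
  "homomorphism A C g \<Longrightarrow> homomorphism C B h \<Longrightarrow> homomorphism A B (h \<circ> g)"
  unfolding homomorphism_def by (auto simp: image_subset_iff) (metis map_map)

lemma pkc_result_correct:
  assumes "csp_coverwidth_instance k A B" "pkc_result k A B B'"
  shows "reports_inconsistency B' \<longleftrightarrow> \<not> satisfiable A B"
proof -
  interpret csp k A B using assms(1) by unfold_locales (simp add: csp_coverwidth_instance_def)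
  obtain H where H: "B' = struct_of H" "remove_step\<^sup>*\<^sup>* initial_maps H" "\<And>f. f \<in> H \<Longrightarrow> supported H f"
    using assms(2) unfolding pkc_result_iff by auto
  have sub: "H \<subseteq> initial_maps" using remove_steps_subset[OF H(2)] .
  obtain C :: "('a, nat) rel_struct" and g h where C: "finite_structure C" "coverwidth C \<le> k"
    "homomorphism A C g" "homomorphism C A h"
    using assms(1) unfolding csp_coverwidth_instance_def hom_equivalent_def by auto
  have "satisfiable A B" if ne: "H \<noteq> {}"
  proof -
    obtain N :: "nat set" and F X where NFX: "tree_decomposition (univ C) (hyperedges C) N F X"
      "\<And>t. t \<in> N \<Longrightarrow> weight (hyperedges C) (X t) \<le> k"
      by (rule coverwidth_decomposition[OF C(1,2)]) (rule that)
    have "satisfiable C B"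
      using decomposition_homomorphism[OF sub ne H(3) C(1,4) NFX] .
    then show ?thesis using homomorphism_comp[OF C(3)] unfolding satisfiable_def by metis
  qed
  moreover have "H \<noteq> {}" if "satisfiable A B" using satisfiable_nonempty[OF that H(2)] .
  ultimately show ?thesis using reports_inconsistency_struct_of[OF sub] H(1) by auto
qed

section \<open>Evaluation within a step bound\<close>

text \<open>Upper bounds, unlike exact step counts, can be weakened to a common value before they
  are combined, which gives all iterations of a loop the same cost.\<close>

definition evalb :: "program \<Rightarrow> data list \<Rightarrow> expr \<Rightarrow> data \<Rightarrow> nat \<Rightarrow> bool" where
  "evalb P env e w c \<longleftrightarrow> (\<exists>n \<le> c. eval P env e w n)"

definition evalsb :: "program \<Rightarrow> data list \<Rightarrow> expr list \<Rightarrow> data list \<Rightarrow> nat \<Rightarrow> bool" where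
  "evalsb P env es ws c \<longleftrightarrow> (\<exists>n \<le> c. evals P env es ws n)"

lemma evalb_weaken: "evalb P env e w c \<Longrightarrow> w = w' \<Longrightarrow> c \<le> c' \<Longrightarrow> evalb P env e w' c'"
  unfolding evalb_def using le_trans by blast

lemma evalsb_weaken: "evalsb P env es ws c \<Longrightarrow> c \<le> c' \<Longrightarrow> evalsb P env es ws c'"
  unfolding evalsb_def using le_trans by blast

lemma evalb_Var: "i < length env \<Longrightarrow> env ! i = w \<Longrightarrow> evalb P env (Var i) w 1"
  unfolding evalb_def using eval_Var by blast

lemma evalb_ELeaf: "evalb P env ELeaf Leaf 1"
  unfolding evalb_def using eval_Leaf by blast

lemma evalb_ENode:
  "evalb P env e\<^sub>1 v\<^sub>1 c\<^sub>1 \<Longrightarrow> evalb P env e\<^sub>2 v\<^sub>2 c\<^sub>2 \<Longrightarrow> evalb P env (ENode e\<^sub>1 e\<^sub>2) (Node v\<^sub>1 v\<^sub>2) (c\<^sub>1 + c\<^sub>2 + 1)"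
  unfolding evalb_def by (meson add_mono eval_Node le_refl)

lemma evalb_ELeft: "evalb P env e v c \<Longrightarrow> left v = w \<Longrightarrow> evalb P env (ELeft e) w (c + 1)"
  unfolding evalb_def by (meson add_right_mono eval_Left)

lemma evalb_ERight: "evalb P env e v c \<Longrightarrow> right v = w \<Longrightarrow> evalb P env (ERight e) w (c + 1)"
  unfolding evalb_def by (meson add_right_mono eval_Right)

lemma evalb_If_True:
  assumes "evalb P env e v c" "v \<noteq> Leaf" "evalb P env e\<^sub>1 w c\<^sub>1"
  shows "evalb P env (If e e\<^sub>1 e\<^sub>2) w (c + c\<^sub>1 + 1)"
  using assms unfolding evalb_def by (meson add_mono eval_If_True le_refl)

lemma evalb_If_False:
  assumes "evalb P env e v c" "v = Leaf" "evalb P env e\<^sub>2 w c\<^sub>2"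
  shows "evalb P env (If e e\<^sub>1 e\<^sub>2) w (c + c\<^sub>2 + 1)"
  using assms unfolding evalb_def by (meson add_mono eval_If_False le_refl)

text \<open>Both branches are charged and the value is a conditional, so the rule applies without a
  decision on the test. The two preceding rules serve tests with a known outcome.\<close>

lemma evalb_If:
  assumes "evalb P env e v c" "v \<noteq> Leaf \<Longrightarrow> evalb P env e\<^sub>1 w\<^sub>1 c\<^sub>1" "v = Leaf \<Longrightarrow> evalb P env e\<^sub>2 w\<^sub>2 c\<^sub>2"
  shows "evalb P env (If e e\<^sub>1 e\<^sub>2) (if v = Leaf then w\<^sub>2 else w\<^sub>1) (c + c\<^sub>1 + c\<^sub>2 + 1)"
proof (cases "v = Leaf")
  case True
  show ?thesis
    by (rule evalb_weaken[OF evalb_If_False[OF assms(1) True assms(3)[OF True]]]) (use True in auto)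
next
  case False
  show ?thesis
    by (rule evalb_weaken[OF evalb_If_True[OF assms(1) False assms(2)[OF False]]]) (use False in auto)
qed

lemma evalsb_Nil: "evalsb P env [] [] 0"
  unfolding evalsb_def using evals_Nil by blast

lemma evalsb_Cons:
  "evalb P env e w c \<Longrightarrow> evalsb P env es ws d \<Longrightarrow> evalsb P env (e # es) (w # ws) (c + d)"
  unfolding evalb_def evalsb_def by (meson add_mono evals_Cons)

lemma evalb_Call:
  "f < length P \<Longrightarrow> evalsb P env es vs c \<Longrightarrow> evalb P vs (P ! f) w d \<Longrightarrow>
   evalb P env (Call f es) w (c + d + 1)"
  unfolding evalb_def evalsb_def by (meson add_mono eval_Call le_refl)

lemmas evalb_rules = evalb_Var evalb_ELeaf evalb_ENode evalb_ELeft evalb_ERight evalb_If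
  evalsb_Nil evalsb_Cons evalb_Call

section \<open>Loops over lists\<close>

definition code_bool :: "bool \<Rightarrow> data" where
  "code_bool b = (if b then Node Leaf Leaf else Leaf)"

lemma code_bool_eq_Leaf [simp]: "code_bool b = Leaf \<longleftrightarrow> \<not> b"
  by (simp add: code_bool_def)

abbreviation ETrue :: expr where "ETrue \<equiv> ENode ELeaf ELeaf"

text \<open>In a loop \<open>Var 0\<close> is the list still to be processed; the other arguments
  are handed on unchanged.\<close>

definition params :: "nat \<Rightarrow> expr list" where
  "params n = map Var [1..<Suc n]"

lemma evalsb_params:
  "length ps = n \<Longrightarrow> evalsb P (x # ps) (params n) ps n"
proof -
  \<comment> \<open>The arbitrary prefix \<open>xs\<close> lets the induction move parameters that
    are already evaluated into it.\<close>
  have "evalsb P (xs @ ps) (map Var [length xs..<length xs + length ps]) ps (length ps)" for xs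
  proof (induction ps arbitrary: xs)
    case Nil
    show ?case by (simp add: evalsb_Nil)
  next
    case (Cons p ps)
    have "evalsb P ((xs @ [p]) @ ps) (map Var [length (xs @ [p])..<length (xs @ [p]) + length ps]) ps (length ps)"
      by (rule Cons.IH)
    then have "evalsb P (xs @ p # ps) (map Var [Suc (length xs)..<length xs + length (p # ps)]) ps (length ps)"
      by simp
    moreover have "evalb P (xs @ p # ps) (Var (length xs)) p 1" by (rule evalb_Var) auto
    moreover have "[length xs..<length xs + length (p # ps)] =
        length xs # [Suc (length xs)..<length xs + length (p # ps)]"
      by (rule upt_conv_Cons) simp
    ultimately show ?case
      using evalsb_Cons[of P "xs @ p # ps" "Var (length xs)" p 1] by fastforce
  qed
  from this[of "[x]"] show "length ps = n \<Longrightarrow> evalsb P (x # ps) (params n) ps n"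
    by (simp add: params_def)
qed

text \<open>The language is first order, so a loop is a scheme for function bodies: \<open>f\<close>
  is the index of the loop itself, \<open>g\<close> that of the function applied to each item, and
  \<open>n\<close> counts the parameters handed on.\<close>

definition exists_loop :: "nat \<Rightarrow> nat \<Rightarrow> nat \<Rightarrow> expr" where
  "exists_loop f g n = If (Var 0)
     (If (Call g (ELeft (Var 0) # params n)) ETrue (Call f (ERight (Var 0) # params n))) ELeaf"

definition concat_loop :: "nat \<Rightarrow> nat \<Rightarrow> nat \<Rightarrow> nat \<Rightarrow> expr" where
  "concat_loop app f g n = If (Var 0)
     (Call app [Call g (ELeft (Var 0) # params n), Call f (ERight (Var 0) # params n)]) ELeaf"

definition append_body :: "nat \<Rightarrow> expr" where
  "append_body f = If (Var 0) (ENode (ELeft (Var 0)) (Call f [ERight (Var 0), Var 1])) (Var 1)"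

text \<open>Here \<open>M\<close> bounds the length of the list and \<open>t\<close> the cost of one
  item. The constant 40 is a generous allowance for control flow, and the additional round pays for
  the empty list.\<close>

definition loop_time :: "nat \<Rightarrow> nat \<Rightarrow> nat" where
  "loop_time M t = (M + 1) * (t + 40)"

lemma loop_time_mono: "l \<le> M \<Longrightarrow> l * (t + 40) + 40 \<le> loop_time M t"
  unfolding loop_time_def add_mult_distrib[of M 1] mult_1
  by (drule mult_le_mono1[of l M "t + 40"]) linarith

text \<open>The cost 6 is 2 for taking the head or tail plus 1 for each of at most 4
  parameters.\<close>

lemma evalb_args:
  assumes "length ps = n" "n \<le> 4"
  shows "evalsb P (Node x y # ps) (ELeft (Var 0) # params n) (x # ps) 6"
    and "evalsb P (Node x y # ps) (ERight (Var 0) # params n) (y # ps) 6"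
proof -
  have *: "evalsb P (Node x y # ps) (e # params n) (z # ps) 6"
    if "evalb P (Node x y # ps) e z 2" for e z
    by (rule evalsb_weaken[OF evalsb_Cons[OF that evalsb_params[OF assms(1)]]]) (use assms(2) in simp)
  show "evalsb P (Node x y # ps) (ELeft (Var 0) # params n) (x # ps) 6"
    by (rule *, rule evalb_weaken, (rule evalb_rules | simp)+)
  show "evalsb P (Node x y # ps) (ERight (Var 0) # params n) (y # ps) 6"
    by (rule *, rule evalb_weaken, (rule evalb_rules | simp)+)
qed

lemma evalb_exists_loop:
  assumes body: "P ! f = exists_loop f g n" and fg: "f < length P" "g < length P"
    and n: "length ps = n" "n \<le> 4" and len: "length ys \<le> M"
    and step: "\<And>y. y \<in> set ys \<Longrightarrow> evalb P (enc y # ps) (P ! g) (code_bool (Q y)) t"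
  shows "evalb P (code_list (map enc ys) # ps) (P ! f) (code_bool (\<exists>y \<in> set ys. Q y)) (loop_time M t)"
proof -
  have "evalb P (code_list (map enc ys) # ps) (P ! f) (code_bool (\<exists>y \<in> set ys. Q y))
      (length ys * (t + 40) + 40)"
    using step
  proof (induction ys)
    case Nil
    show ?case unfolding body exists_loop_def
      by (rule evalb_weaken, rule evalb_If_False, (rule evalb_rules | simp)+) (simp_all add: code_bool_def)
  next
    case (Cons y ys)
    note args = evalb_args[OF n, of P "enc y" "code_list (map enc ys)"]
    have 1: "evalb P (code_list (map enc ys) # ps) (P ! f) (code_bool (\<exists>y \<in> set ys. Q y))
      (length ys * (t + 40) + 40)" using Cons by simp
    have 2: "evalb P (enc y # ps) (P ! g) (code_bool (Q y)) t" using Cons by simp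
    show ?case unfolding body exists_loop_def
      apply (rule evalb_weaken)
        apply (rule evalb_If_True)
          apply (rule evalb_Var; simp)
         apply simp
        apply (rule evalb_If)
          apply (simp, rule evalb_Call[OF fg(2) args(1) 2])
         apply (rule evalb_ENode evalb_ELeaf)+
        apply (simp, rule evalb_Call[OF fg(1) args(2) 1])
       apply (simp_all add: code_bool_def)
      done
  qed
  then show ?thesis by (rule evalb_weaken) (simp_all add: loop_time_mono len)
qed

lemma evalb_append:
  assumes "P ! f = append_body f" "f < length P"
  shows "evalb P [code_list xs, code_list ys] (P ! f) (code_list (xs @ ys)) (20 * length xs + 20)"
proof (induction xs)
  case Nil
  show ?case unfolding assms(1) append_body_def
    by (rule evalb_weaken, rule evalb_If_False, (rule evalb_rules | simp)+)
next
  case (Cons x xs)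
  show ?case unfolding assms(1) append_body_def
    apply (rule evalb_weaken)
      apply (rule evalb_If_True)
        apply (rule evalb_Var; simp)
       apply simp
      apply (rule evalb_ENode evalb_Call[OF assms(2) _ Cons.IH] evalb_rules | simp)+
    done
qed

text \<open>\<open>fAppend\<close> traverses its first argument only, here the result for one item.
  This adds at most \<open>20 * M\<close> and a constant to each iteration, however long the
  accumulated list is.\<close>

lemma evalb_concat_loop:
  assumes body: "P ! f = concat_loop h f g n" "P ! h = append_body h"
    and fg: "f < length P" "g < length P" "h < length P"
    and n: "length ps = n" "n \<le> 4" and len: "length ys \<le> M"
    and step: "\<And>y. y \<in> set ys \<Longrightarrow> evalb P (enc y # ps) (P ! g) (code_list (G y)) t"
    and len_G: "\<And>y. y \<in> set ys \<Longrightarrow> length (G y) \<le> M"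
  shows "evalb P (code_list (map enc ys) # ps) (P ! f) (code_list (concat (map G ys)))
     (loop_time M (t + 20 * M))"
proof -
  have "evalb P (code_list (map enc ys) # ps) (P ! f) (code_list (concat (map G ys)))
     (length ys * ((t + 20 * M) + 40) + 40)"
    using step len_G
  proof (induction ys)
    case Nil
    show ?case unfolding body concat_loop_def
      by (rule evalb_weaken, rule evalb_If_False, (rule evalb_rules | simp)+)
  next
    case (Cons y ys)
    note args = evalb_args[OF n, of P "enc y" "code_list (map enc ys)"]
    have 1: "evalb P (code_list (map enc ys) # ps) (P ! f) (code_list (concat (map G ys)))
     (length ys * ((t + 20 * M) + 40) + 40)" using Cons by simp
    have 2: "evalb P (enc y # ps) (P ! g) (code_list (G y)) t" using Cons by simp
    have 3: "evalsb P (code_list (map enc (y # ys)) # ps)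
        [Call g (ELeft (Var 0) # params n), Call f (ERight (Var 0) # params n)]
        [code_list (G y), code_list (concat (map G ys))]
        ((6 + t + 1) + ((6 + (length ys * ((t + 20 * M) + 40) + 40) + 1) + 0))"
      unfolding list.map code_list.simps
      by (rule evalsb_Cons[OF evalb_Call[OF fg(2) args(1) 2]
          evalsb_Cons[OF evalb_Call[OF fg(1) args(2) 1] evalsb_Nil]])
    have "length (G y) \<le> M" using Cons.prems by simp
    then show ?case unfolding body concat_loop_def
      by (intro evalb_weaken[OF evalb_If_True[OF evalb_Var _
            evalb_Call[OF fg(3) 3 evalb_append[OF body(2) fg(3)]]]]) simp+
  qed
  then show ?thesis by (rule evalb_weaken) (simp_all add: loop_time_mono len)
qed

corollary evalb_concat_map_loop:
  assumes "P ! f = concat_loop h f g n" "P ! h = append_body h"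
    and "f < length P" "g < length P" "h < length P" "length ps = n" "n \<le> 4"
    and "\<And>y. y \<in> set ys \<Longrightarrow> evalb P (enc y # ps) (P ! g) (code_list (map enc' (G y))) t"
    and "length ys \<le> M" and "\<And>y. y \<in> set ys \<Longrightarrow> length (G y) \<le> M"
  shows "evalb P (code_list (map enc ys) # ps) (P ! f) (code_list (map enc' (concat (map G ys))))
     (loop_time M (t + 20 * M))"
proof -
  have "evalb P (code_list (map enc ys) # ps) (P ! f) (code_list (concat (map (\<lambda>y. map enc' (G y)) ys)))
     (loop_time M (t + 20 * M))"
    by (rule evalb_concat_loop[OF assms(1-5)]) (use assms(6-) in simp_all)
  then show ?thesis by (simp only: map_concat map_map comp_def)
qed

section \<open>The program\<close>

abbreviation (input) "fMain \<equiv> 0 :: nat"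
abbreviation (input) "fSolve \<equiv> 1 :: nat"
abbreviation (input) "fEqual \<equiv> 2 :: nat"
abbreviation (input) "fAppend \<equiv> 3 :: nat"
abbreviation (input) "fZip \<equiv> 4 :: nat"
abbreviation (input) "fLookup \<equiv> 5 :: nat"
abbreviation (input) "fClash \<equiv> 6 :: nat"
abbreviation (input) "fConflict \<equiv> 7 :: nat"
abbreviation (input) "fMissing \<equiv> 8 :: nat"
abbreviation (input) "fUncovered \<equiv> 9 :: nat"
abbreviation (input) "fMatchOne \<equiv> 10 :: nat"
abbreviation (input) "fMatchB \<equiv> 11 :: nat"
abbreviation (input) "fMatchA \<equiv> 12 :: nat"
abbreviation (input) "fMatches \<equiv> 13 :: nat"
abbreviation (input) "fJoin \<equiv> 14 :: nat"
abbreviation (input) "fJoins \<equiv> 15 :: nat"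
abbreviation (input) "fJoinAll \<equiv> 16 :: nat"
abbreviation (input) "fCross \<equiv> 17 :: nat"
abbreviation (input) "fPower \<equiv> 18 :: nat"
abbreviation (input) "fEdge \<equiv> 19 :: nat"
abbreviation (input) "fEdges \<equiv> 20 :: nat"
abbreviation (input) "fFits \<equiv> 21 :: nat"
abbreviation (input) "fSomeFits \<equiv> 22 :: nat"
abbreviation (input) "fUnfit \<equiv> 23 :: nat"
abbreviation (input) "fSomeUnfit \<equiv> 24 :: nat"
abbreviation (input) "fSelectOne \<equiv> 25 :: nat"
abbreviation (input) "fSelect \<equiv> 26 :: nat"
abbreviation (input) "fAgrees \<equiv> 27 :: nat"
abbreviation (input) "fSomeAgrees \<equiv> 28 :: nat"
abbreviation (input) "fUnsupported \<equiv> 29 :: nat"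
abbreviation (input) "fSomeUnsupported \<equiv> 30 :: nat"
abbreviation (input) "fKeep \<equiv> 31 :: nat"
abbreviation (input) "fPrune \<equiv> 32 :: nat"
abbreviation (input) "fIterate \<equiv> 33 :: nat"
abbreviation (input) "fRun \<equiv> 34 :: nat"

text \<open>The number \<open>k\<close> is part of the program and not of its input; it enters as a
  list of \<open>k\<close> leaves on which \<open>fPower\<close> recurses.\<close>

fun literal :: "nat \<Rightarrow> expr" where
  "literal 0 = ELeaf"
| "literal (Suc n) = ENode ELeaf (literal n)"

text \<open>A loop runs over its first argument, so \<open>fMatchA\<close> and
  \<open>fJoinAll\<close> merely swap their arguments to start an inner loop. There are no local
  bindings, which is why \<open>fClash\<close> performs its lookup twice.\<close>

definition prog :: "nat \<Rightarrow> program" where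
  "prog k = [
    \<comment> \<open>fMain\<close> Call fSolve [ERight (ELeft (Var 0)), ERight (ERight (Var 0))],
    \<comment> \<open>fSolve\<close> If (Var 0)
      (Call fRun [Call fPower [literal k, Call fMatches [Var 0, Var 1]],
        Call fPower [literal k, Call fEdges [Var 0]], Var 0, Var 1])
      (ENode ELeaf ELeaf),
    \<comment> \<open>fEqual\<close> If (Var 0)
      (If (Var 1) (If (Call fEqual [ELeft (Var 0), ELeft (Var 1)])
        (Call fEqual [ERight (Var 0), ERight (Var 1)]) ELeaf) ELeaf)
      (If (Var 1) ELeaf ETrue),
    \<comment> \<open>fAppend\<close> append_body fAppend,
    \<comment> \<open>fZip\<close> If (Var 0) (If (Var 1) (ENode (ENode (ELeft (Var 0)) (ELeft (Var 1)))
      (Call fZip [ERight (Var 0), ERight (Var 1)])) ELeaf) ELeaf,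
    \<comment> \<open>fLookup\<close> If (Var 0)
      (If (Call fEqual [ELeft (ELeft (Var 0)), Var 1]) (ENode (ERight (ELeft (Var 0))) ELeaf)
        (Call fLookup [ERight (Var 0), Var 1]))
      ELeaf,
    \<comment> \<open>fClash\<close> If (Call fLookup [Var 1, ELeft (Var 0)])
      (If (Call fEqual [ERight (Var 0), ELeft (Call fLookup [Var 1, ELeft (Var 0)])]) ELeaf ETrue) ELeaf,
    \<comment> \<open>fConflict\<close> exists_loop fConflict fClash 1,
    \<comment> \<open>fMissing\<close> If (Call fLookup [Var 1, ELeft (Var 0)]) ELeaf ETrue,
    \<comment> \<open>fUncovered\<close> exists_loop fUncovered fMissing 1,
    \<comment> \<open>fMatchOne\<close> If (Call fEqual [ELeft (Var 1), ELeft (Var 0)])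
      (ENode (Call fZip [ERight (Var 1), ERight (Var 0)]) ELeaf) ELeaf,
    \<comment> \<open>fMatchB\<close> concat_loop fAppend fMatchB fMatchOne 1,
    \<comment> \<open>fMatchA\<close> Call fMatchB [Var 1, Var 0],
    \<comment> \<open>fMatches\<close> concat_loop fAppend fMatches fMatchA 1,
    \<comment> \<open>fJoin\<close> ENode (Call fAppend [Var 1, Var 0]) ELeaf,
    \<comment> \<open>fJoins\<close> concat_loop fAppend fJoins fJoin 1,
    \<comment> \<open>fJoinAll\<close> Call fJoins [Var 1, Var 0],
    \<comment> \<open>fCross\<close> concat_loop fAppend fCross fJoinAll 1,
    \<comment> \<open>fPower\<close> If (Var 0) (Call fCross [Var 1, Call fPower [ERight (Var 0), Var 1]])
      (ENode ELeaf ELeaf),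
    \<comment> \<open>fEdge\<close> ENode (Call fZip [ERight (Var 0), ERight (Var 0)]) ELeaf,
    \<comment> \<open>fEdges\<close> concat_loop fAppend fEdges fEdge 0,
    \<comment> \<open>fFits\<close> If (Call fEqual [ELeft (Var 1), ELeft (Var 0)])
      (If (Call fConflict [Call fZip [ERight (Var 1), ERight (Var 0)], Var 2]) ELeaf ETrue) ELeaf,
    \<comment> \<open>fSomeFits\<close> exists_loop fSomeFits fFits 2,
    \<comment> \<open>fUnfit\<close> If (Call fSomeFits [Var 1, Var 0, Var 2]) ELeaf ETrue,
    \<comment> \<open>fSomeUnfit\<close> exists_loop fSomeUnfit fUnfit 2,
    \<comment> \<open>fSelectOne\<close> If (Call fConflict [Var 0, Var 0]) ELeaf
      (If (Call fSomeUnfit [Var 1, Var 2, Var 0]) ELeaf (ENode (Var 0) ELeaf)),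
    \<comment> \<open>fSelect\<close> concat_loop fAppend fSelect fSelectOne 2,
    \<comment> \<open>fAgrees\<close> If (Call fUncovered [Var 1, Var 0]) ELeaf
      (If (Call fUncovered [Var 0, Var 1]) ELeaf
        (If (Call fConflict [Var 0, Var 2]) ELeaf ETrue)),
    \<comment> \<open>fSomeAgrees\<close> exists_loop fSomeAgrees fAgrees 2,
    \<comment> \<open>fUnsupported\<close> If (Call fSomeAgrees [Var 2, Var 0, Var 1]) ELeaf ETrue,
    \<comment> \<open>fSomeUnsupported\<close> exists_loop fSomeUnsupported fUnsupported 2,
    \<comment> \<open>fKeep\<close> If (Call fSomeUnsupported [Var 2, Var 0, Var 1]) ELeaf (ENode (Var 0) ELeaf),
    \<comment> \<open>fPrune\<close> concat_loop fAppend fPrune fKeep 2,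
    \<comment> \<open>fIterate\<close> If (Var 0)
      (Call fIterate [ERight (Var 0), Call fPrune [Var 1, Var 1, Var 2], Var 2]) (Var 1),
    \<comment> \<open>fRun\<close> Call fIterate [Var 0, Call fSelect [Var 0, Var 2, Var 3], Var 1]]"

lemma length_prog [simp]: "length (prog k) = 35"
  by (simp add: prog_def)

section \<open>The functions computed by the program\<close>

type_synonym amap = "(data \<times> data) list"
type_synonym tuple = "data \<times> data list"

definition code_pair :: "data \<times> data \<Rightarrow> data" where
  "code_pair p = Node (fst p) (snd p)"

definition code_map :: "amap \<Rightarrow> data" where
  "code_map m = code_list (map code_pair m)"

definition code_tuple :: "tuple \<Rightarrow> data" where
  "code_tuple t = Node (fst t) (code_list (snd t))"

abbreviation "code_maps ms \<equiv> code_list (map code_map ms)"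
abbreviation "code_tups ts \<equiv> code_list (map code_tuple ts)"

definition clash :: "amap \<Rightarrow> data \<times> data \<Rightarrow> bool" where
  "clash m p \<longleftrightarrow> (\<exists>b. map_of m (fst p) = Some b \<and> snd p \<noteq> b)"

text \<open>Keys that \<open>m\<close> lacks never clash. With equal arguments the test detects
  entries shadowed by a different value.\<close>

definition conflict :: "amap \<Rightarrow> amap \<Rightarrow> bool" where
  "conflict m' m \<longleftrightarrow> (\<exists>p \<in> set m'. clash m p)"

definition uncovered :: "amap \<Rightarrow> amap \<Rightarrow> bool" where
  "uncovered m' m \<longleftrightarrow> (\<exists>p \<in> set m'. map_of m (fst p) = None)"

text \<open>If a tuple of \<open>A\<close> repeats an element, its pairing can assign two values to
  it; \<open>select\<close> sorts out such lists later.\<close>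

definition matches :: "tuple list \<Rightarrow> tuple list \<Rightarrow> amap list" where
  "matches ts us = concat (map (\<lambda>t. concat (map (\<lambda>u.
     if fst t = fst u then [zip (snd t) (snd u)] else []) us)) ts)"

text \<open>Only the keys matter. Pairing each tuple with itself gives hyperedges the format of
  maps, so that \<open>concats\<close> can enumerate the unions as well.\<close>

definition edges :: "tuple list \<Rightarrow> amap list" where
  "edges ts = concat (map (\<lambda>t. [zip (snd t) (snd t)]) ts)"

definition cross :: "amap list \<Rightarrow> amap list \<Rightarrow> amap list" where
  "cross xs ys = concat (map (\<lambda>x. concat (map (\<lambda>y. [x @ y]) ys)) xs)"

fun concats :: "nat \<Rightarrow> amap list \<Rightarrow> amap list" where
  "concats 0 xs = [[]]"
| "concats (Suc n) xs = cross xs (concats n xs)"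

definition fits :: "amap \<Rightarrow> tuple \<Rightarrow> tuple \<Rightarrow> bool" where
  "fits m t u \<longleftrightarrow> fst t = fst u \<and> \<not> conflict (zip (snd t) (snd u)) m"

text \<open>Maps without internal conflicts have no shadowed entries, so that testing all entries of an
association list amounts to testing the map it stands for.\<close>

definition projective :: "tuple list \<Rightarrow> tuple list \<Rightarrow> amap \<Rightarrow> bool" where
  "projective ts us m \<longleftrightarrow> \<not> conflict m m \<and> \<not> (\<exists>t \<in> set ts. \<not> (\<exists>u \<in> set us. fits m t u))"

definition select :: "amap list \<Rightarrow> tuple list \<Rightarrow> tuple list \<Rightarrow> amap list" where
  "select ms ts us = concat (map (\<lambda>m. if projective ts us m then [m] else []) ms)"

text \<open>The list \<open>W\<close> stands for its key set, a union that has to be exactly the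
  domain of \<open>m'\<close>.\<close>

definition agrees :: "amap \<Rightarrow> amap \<Rightarrow> amap \<Rightarrow> bool" where
  "agrees W m m' \<longleftrightarrow> \<not> uncovered W m' \<and> \<not> uncovered m' W \<and> \<not> conflict m' m"

definition unsupported :: "amap list \<Rightarrow> amap list \<Rightarrow> amap \<Rightarrow> bool" where
  "unsupported S Ws m \<longleftrightarrow> (\<exists>W \<in> set Ws. \<not> (\<exists>m' \<in> set S. agrees W m m'))"

definition prune :: "amap list \<Rightarrow> amap list \<Rightarrow> amap list" where
  "prune Ws S = concat (map (\<lambda>m. if unsupported S Ws m then [] else [m]) S)"

text \<open>If \<open>A\<close> has no tuples, its only \<open>k\<close>-union is the empty one, whereas there are no \<open>k\<close>-fold
concatenations for \<open>k \<ge> 1\<close>.\<close>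

definition solve :: "nat \<Rightarrow> tuple list \<Rightarrow> tuple list \<Rightarrow> amap list" where
  "solve k ts us = (if ts = [] then [[]] else
     (let ms = concats k (matches ts us) in
      (prune (concats k (edges ts)) ^^ length ms) (select ms ts us)))"

section \<open>Size and time bounds\<close>

definition small_map :: "nat \<Rightarrow> amap \<Rightarrow> bool" where
  "small_map M m \<longleftrightarrow> length m \<le> M \<and> (\<forall>p \<in> set m. size (fst p) \<le> M \<and> size (snd p) \<le> M)"

definition small_tuple :: "nat \<Rightarrow> tuple \<Rightarrow> bool" where
  "small_tuple M t \<longleftrightarrow> size (fst t) \<le> M \<and> length (snd t) \<le> M \<and> (\<forall>x \<in> set (snd t). size x \<le> M)"

definition small_maps :: "nat \<Rightarrow> amap list \<Rightarrow> bool" where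
  "small_maps M ms \<longleftrightarrow> length ms \<le> M \<and> (\<forall>m \<in> set ms. small_map M m)"

definition small_tuples :: "nat \<Rightarrow> tuple list \<Rightarrow> bool" where
  "small_tuples M ts \<longleftrightarrow> length ts \<le> M \<and> (\<forall>t \<in> set ts. small_tuple M t)"

text \<open>The time bounds follow the call structure of the program and depend on the size bound
  \<open>M\<close>, besides \<open>k\<close>; their additive constants are generous.\<close>

definition "t_equal M = 60 * M + (20 :: nat)"
definition "t_zip M = 60 * M + (20 :: nat)"
definition "t_lookup M = loop_time M (t_equal M)"
definition "t_clash M = 2 * t_lookup M + t_equal M + 40"
definition "t_conflict M = loop_time M (t_clash M)"
definition "t_missing M = t_lookup M + 40"
definition "t_uncovered M = loop_time M (t_missing M)"
definition "t_match_one M = t_equal M + t_zip M + 40"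
definition "t_match_a M = loop_time M (t_match_one M + 20 * M) + 40"
definition "t_matches M = loop_time M (t_match_a M + 20 * M)"
definition "t_join M = 20 * M + (40 :: nat)"
definition "t_join_all M = loop_time M (t_join M + 20 * M) + 40"
definition "t_cross M = loop_time M (t_join_all M + 20 * M)"
definition "t_power k M = (k + 1) * (t_cross M + 40)"
definition "t_edge M = t_zip M + 40"
definition "t_edges M = loop_time M (t_edge M + 20 * M)"
definition "t_fits M = t_equal M + t_zip M + t_conflict M + 60"
definition "t_unfit M = loop_time M (t_fits M) + 40"
definition "t_select_one M = t_conflict M + loop_time M (t_unfit M) + 60"
definition "t_select M = loop_time M (t_select_one M + 20 * M)"
definition "t_agrees M = 2 * t_uncovered M + t_conflict M + 60"
definition "t_unsupported M = loop_time M (t_agrees M) + 40"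
definition "t_keep M = loop_time M (t_unsupported M) + 40"
definition "t_prune M = loop_time M (t_keep M + 20 * M)"
definition "t_iterate M = loop_time M (t_prune M)"
definition "t_run M = t_select M + t_iterate M + 60"
definition "t_solve k M = t_matches M + t_edges M + 2 * t_power k M + t_run M + 4 * k + 140"

section \<open>Value and cost of each function\<close>

text \<open>Both trees are descended in parallel, so the first one alone limits the descent and it
  suffices that one of the compared values is small.\<close>

lemma evalb_equal:
  "evalb (prog k) [x, y] (prog k ! fEqual) (code_bool (x = y)) (60 * size x + 20)"
proof (induction x arbitrary: y)
  case Leaf
  have body: "prog k ! fEqual = If (Var 0)
      (If (Var 1) (If (Call fEqual [ELeft (Var 0), ELeft (Var 1)])
        (Call fEqual [ERight (Var 0), ERight (Var 1)]) ELeaf) ELeaf)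
      (If (Var 1) ELeaf ETrue)" by (simp add: prog_def)
  show ?case unfolding body
    by (rule evalb_weaken, rule evalb_If_False, (rule evalb_rules | simp)+) (auto simp: code_bool_def)
next
  case (Node l r)
  have body: "prog k ! fEqual = If (Var 0)
      (If (Var 1) (If (Call fEqual [ELeft (Var 0), ELeft (Var 1)])
        (Call fEqual [ERight (Var 0), ERight (Var 1)]) ELeaf) ELeaf)
      (If (Var 1) ELeaf ETrue)" by (simp add: prog_def)
  show ?case
  proof (cases y)
    case Leaf
    show ?thesis unfolding body Leaf
      by (rule evalb_weaken, rule evalb_If_True, rule evalb_Var, simp, rule refl, simp,
          rule evalb_If_False, (rule evalb_rules | simp)+) (auto simp: code_bool_def)
  next
    case y: (Node l' r')
    show ?thesis unfolding body y
      by (rule evalb_weaken, rule evalb_If_True, rule evalb_Var, simp, rule refl, simp,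
          rule evalb_If_True, rule evalb_Var, simp, simp, simp,
          (rule Node.IH evalb_rules | simp)+) (auto simp: code_bool_def)
  qed
qed


lemma evalb_equal_le:
  "size x \<le> M \<Longrightarrow> evalb (prog k) [x, y] (prog k ! fEqual) (code_bool (x = y)) (t_equal M)"
  by (rule evalb_weaken[OF evalb_equal]) (simp_all add: t_equal_def)

lemma evalb_append_prog:
  "evalb (prog k) [code_list xs, code_list ys] (prog k ! fAppend) (code_list (xs @ ys)) (20 * length xs + 20)"
  by (rule evalb_append) (simp_all add: prog_def)

lemma evalb_zip:
  "evalb (prog k) [code_list xs, code_list ys] (prog k ! fZip) (code_map (zip xs ys)) (60 * length xs + 20)"
proof (induction xs arbitrary: ys)
  case Nil
  show ?case unfolding prog_def
    by (rule evalb_weaken, simp, rule evalb_If_False, (rule evalb_rules | simp)+) (auto simp: code_map_def)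
next
  case (Cons x xs)
  have body: "prog k ! fZip = If (Var 0) (If (Var 1) (ENode (ENode (ELeft (Var 0)) (ELeft (Var 1)))
      (Call fZip [ERight (Var 0), ERight (Var 1)])) ELeaf) ELeaf" by (simp add: prog_def)
  show ?case
  proof (cases ys)
    case Nil
    show ?thesis unfolding body Nil
      by (rule evalb_weaken, rule evalb_If_True, rule evalb_Var, simp, rule refl, simp,
          rule evalb_If_False, (rule evalb_rules | simp)+) (auto simp: code_map_def)
  next
    case ys: (Cons y ys')
    show ?thesis unfolding body ys
      by (rule evalb_weaken, rule evalb_If_True, rule evalb_Var, simp, rule refl, simp,
          rule evalb_If_True, rule evalb_Var, simp, simp, simp,
          (rule Cons.IH evalb_rules | simp)+) (auto simp: code_map_def code_pair_def)
  qed
qed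

text \<open>The wrapping node tells a stored \<open>Leaf\<close> from a missing key.\<close>

definition look :: "amap \<Rightarrow> data \<Rightarrow> data" where
  "look m a = (case map_of m a of None \<Rightarrow> Leaf | Some b \<Rightarrow> Node b Leaf)"

lemma evalb_lookup:
  assumes "small_map M m"
  shows "evalb (prog k) [code_map m, a] (prog k ! fLookup) (look m a) (t_lookup M)"
proof -
  have body: "prog k ! fLookup = If (Var 0)
      (If (Call fEqual [ELeft (ELeft (Var 0)), Var 1]) (ENode (ERight (ELeft (Var 0))) ELeaf)
        (Call fLookup [ERight (Var 0), Var 1]))
      ELeaf" by (simp add: prog_def)
  have *: "evalb (prog k) [code_map m, a] (prog k ! fLookup) (look m a) (length m * (t_equal M + 40) + 40)"
    using assms
  proof (induction m)
    case Nil
    show ?case unfolding body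
      by (rule evalb_weaken, rule evalb_If_False, (rule evalb_rules | simp add: code_map_def)+)
        (auto simp: look_def)
  next
    case (Cons p m)
    have IH: "evalb (prog k) [code_map m, a] (prog k ! fLookup) (look m a)
        (length m * (t_equal M + 40) + 40)"
      using Cons by (auto simp: small_map_def)
    have p: "size (fst p) \<le> M" using Cons.prems by (simp add: small_map_def)
    have m: "code_map (p # m) = Node (Node (fst p) (snd p)) (code_map m)"
      by (simp add: code_map_def code_pair_def)
    show ?case unfolding body m
      by (rule evalb_weaken, rule evalb_If_True, rule evalb_Var, simp, rule refl, simp,
          (rule IH evalb_equal_le[OF p] evalb_rules | simp)+)
        (cases p, auto simp: look_def code_bool_def)
  qed
  have "length m \<le> M" using assms by (simp add: small_map_def)
  then show ?thesis
    by (intro evalb_weaken[OF *]) (simp_all add: t_lookup_def loop_time_mono)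
qed

lemma evalb_clash:
  assumes "small_map M m" "size (snd p) \<le> M"
  shows "evalb (prog k) [code_pair p, code_map m] (prog k ! fClash) (code_bool (clash m p)) (t_clash M)"
proof -
  have body: "prog k ! fClash = If (Call fLookup [Var 1, ELeft (Var 0)])
      (If (Call fEqual [ERight (Var 0), ELeft (Call fLookup [Var 1, ELeft (Var 0)])]) ELeaf ETrue) ELeaf"
    by (simp add: prog_def)
  show ?thesis unfolding body
    by (rule evalb_weaken, (rule evalb_lookup[OF assms(1)] evalb_equal_le[OF assms(2)] evalb_rules
          | simp add: code_pair_def)+)
      (auto simp: look_def code_bool_def clash_def t_clash_def split: option.splits)
qed

lemma evalb_conflict:
  assumes "small_map M m'" "small_map M m"
  shows "evalb (prog k) [code_map m', code_map m] (prog k ! fConflict) (code_bool (conflict m' m)) (t_conflict M)"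
proof -
  have body: "prog k ! fConflict = exists_loop fConflict fClash 1" by (simp add: prog_def)
  show ?thesis unfolding conflict_def t_conflict_def code_map_def[of m']
  proof (rule evalb_exists_loop[OF body])
    show "evalb (prog k) (code_pair p # [code_map m]) (prog k ! fClash) (code_bool (clash m p)) (t_clash M)"
      if "p \<in> set m'" for p
      by (rule evalb_clash[OF assms(2)]) (use that assms(1) in \<open>simp add: small_map_def\<close>)
  qed (use assms in \<open>simp_all add: small_map_def\<close>)
qed

lemma evalb_missing:
  assumes "small_map M m"
  shows "evalb (prog k) [code_pair p, code_map m] (prog k ! fMissing)
    (code_bool (map_of m (fst p) = None)) (t_missing M)"
proof -
  have body: "prog k ! fMissing = If (Call fLookup [Var 1, ELeft (Var 0)]) ELeaf ETrue"
    by (simp add: prog_def)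
  show ?thesis unfolding body
    by (rule evalb_weaken, (rule evalb_lookup[OF assms] evalb_rules | simp add: code_pair_def)+)
      (auto simp: look_def code_bool_def t_missing_def split: option.splits)
qed

lemma evalb_uncovered:
  assumes "small_map M m'" "small_map M m"
  shows "evalb (prog k) [code_map m', code_map m] (prog k ! fUncovered) (code_bool (uncovered m' m)) (t_uncovered M)"
proof -
  have body: "prog k ! fUncovered = exists_loop fUncovered fMissing 1" by (simp add: prog_def)
  show ?thesis unfolding uncovered_def t_uncovered_def code_map_def[of m']
    by (rule evalb_exists_loop[OF body _ _ _ _ _ evalb_missing[OF assms(2)]])
      (use assms in \<open>simp_all add: small_map_def\<close>)
qed

lemma evalb_zip_le:
  "length xs \<le> M \<Longrightarrow>
   evalb (prog k) [code_list xs, code_list ys] (prog k ! fZip) (code_map (zip xs ys)) (t_zip M)"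
  by (rule evalb_weaken[OF evalb_zip]) (simp_all add: t_zip_def)

lemma evalb_match_one:
  assumes "small_tuple M t"
  shows "evalb (prog k) [code_tuple u, code_tuple t] (prog k ! fMatchOne)
    (code_maps (if fst t = fst u then [zip (snd t) (snd u)] else [])) (t_match_one M)"
proof -
  have body: "prog k ! fMatchOne = If (Call fEqual [ELeft (Var 1), ELeft (Var 0)])
      (ENode (Call fZip [ERight (Var 1), ERight (Var 0)]) ELeaf) ELeaf" by (simp add: prog_def)
  have t: "size (fst t) \<le> M" "length (snd t) \<le> M" using assms by (simp_all add: small_tuple_def)
  show ?thesis unfolding body
    by (rule evalb_weaken, (rule evalb_equal_le[OF t(1)] evalb_zip_le[OF t(2)] evalb_rules
          | simp add: code_tuple_def)+)
      (auto simp: code_bool_def t_match_one_def)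
qed

lemma length_concat_map_le: "(\<And>x. x \<in> set xs \<Longrightarrow> length (f x) \<le> 1) \<Longrightarrow> length (concat (map f xs)) \<le> length xs"
proof (induction xs)
  case (Cons x xs)
  then have "length (f x) \<le> 1" "length (concat (map f xs)) \<le> length xs" by simp_all
  then show ?case by simp
qed simp

lemma evalb_match_a:
  assumes "small_tuple M t" "length us \<le> M" "1 \<le> M"
  shows "evalb (prog k) [code_tuple t, code_tups us] (prog k ! fMatchA)
    (code_maps (concat (map (\<lambda>u. if fst t = fst u then [zip (snd t) (snd u)] else []) us))) (t_match_a M)"
proof -
  have body: "prog k ! fMatchA = Call fMatchB [Var 1, Var 0]"
    "prog k ! fMatchB = concat_loop fAppend fMatchB fMatchOne 1"
    "prog k ! fAppend = append_body fAppend" by (simp_all add: prog_def)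
  have *: "evalb (prog k) [code_tups us, code_tuple t] (prog k ! fMatchB)
    (code_maps (concat (map (\<lambda>u. if fst t = fst u then [zip (snd t) (snd u)] else []) us)))
    (loop_time M (t_match_one M + 20 * M))"
    by (rule evalb_concat_map_loop[OF body(2,3) _ _ _ _ _ evalb_match_one[OF assms(1)]])
      (use assms in simp_all)
  show ?thesis unfolding body(1)
    by (rule evalb_weaken, (rule * evalb_rules | simp)+) (simp add: t_match_a_def)
qed

lemma evalb_matches:
  assumes "small_tuples M ts" "length us \<le> M" "1 \<le> M"
  shows "evalb (prog k) [code_tups ts, code_tups us] (prog k ! fMatches) (code_maps (matches ts us)) (t_matches M)"
proof -
  have body: "prog k ! fMatches = concat_loop fAppend fMatches fMatchA 1"
    "prog k ! fAppend = append_body fAppend" by (simp_all add: prog_def)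
  have "length (concat (map (\<lambda>u. if fst t = fst u then [zip (snd t) (snd u)] else []) us)) \<le> M" for t :: tuple
    using assms(2) by (intro le_trans[OF length_concat_map_le]) simp_all
  then show ?thesis unfolding matches_def t_matches_def
    by (intro evalb_concat_map_loop[OF body _ _ _ _ _ evalb_match_a])
      (use assms in \<open>simp_all add: small_tuples_def\<close>)
qed

lemma evalb_join:
  assumes "length x \<le> M"
  shows "evalb (prog k) [code_map y, code_map x] (prog k ! fJoin) (code_maps [x @ y]) (t_join M)"
proof -
  have body: "prog k ! fJoin = ENode (Call fAppend [Var 1, Var 0]) ELeaf" by (simp add: prog_def)
  show ?thesis unfolding body code_map_def
    by (rule evalb_weaken, (rule evalb_append_prog evalb_rules | simp)+)
      (use assms in \<open>simp_all add: t_join_def\<close>)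
qed

lemma evalb_join_all:
  assumes "length x \<le> M" "length ys \<le> M" "1 \<le> M"
  shows "evalb (prog k) [code_map x, code_maps ys] (prog k ! fJoinAll)
    (code_maps (concat (map (\<lambda>y. [x @ y]) ys))) (t_join_all M)"
proof -
  have body: "prog k ! fJoinAll = Call fJoins [Var 1, Var 0]"
    "prog k ! fJoins = concat_loop fAppend fJoins fJoin 1"
    "prog k ! fAppend = append_body fAppend" by (simp_all add: prog_def)
  have *: "evalb (prog k) [code_maps ys, code_map x] (prog k ! fJoins)
    (code_maps (concat (map (\<lambda>y. [x @ y]) ys))) (loop_time M (t_join M + 20 * M))"
    by (rule evalb_concat_map_loop[OF body(2,3) _ _ _ _ _ evalb_join[OF assms(1)]])
      (use assms in simp_all)
  show ?thesis unfolding body(1)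
    by (rule evalb_weaken, (rule * evalb_rules | simp)+) (simp add: t_join_all_def)
qed

lemma evalb_cross:
  assumes "small_maps M xs" "length ys \<le> M" "1 \<le> M"
  shows "evalb (prog k) [code_maps xs, code_maps ys] (prog k ! fCross) (code_maps (cross xs ys)) (t_cross M)"
proof -
  have body: "prog k ! fCross = concat_loop fAppend fCross fJoinAll 1"
    "prog k ! fAppend = append_body fAppend" by (simp_all add: prog_def)
  have "length (concat (map (\<lambda>y. [x @ y]) ys)) \<le> M" for x :: amap
    using assms(2) by (intro le_trans[OF length_concat_map_le]) simp_all
  then show ?thesis unfolding cross_def t_cross_def
    by (intro evalb_concat_map_loop[OF body _ _ _ _ _ evalb_join_all])
      (use assms in \<open>simp_all add: small_maps_def small_map_def\<close>)
qed

lemma evalb_power: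
  assumes "small_maps M xs" "1 \<le> M" "\<And>j. j < n \<Longrightarrow> length (concats j xs) \<le> M"
  shows "evalb (prog k) [code_list (replicate n Leaf), code_maps xs] (prog k ! fPower)
    (code_maps (concats n xs)) (t_power n M)"
  using assms(3)
proof (induction n)
  case 0
  have body: "prog k ! fPower = If (Var 0) (Call fCross [Var 1, Call fPower [ERight (Var 0), Var 1]])
      (ENode ELeaf ELeaf)" by (simp add: prog_def)
  show ?case unfolding body
    by (rule evalb_weaken, rule evalb_If_False, (rule evalb_rules | simp)+)
      (simp_all add: t_power_def code_map_def)
next
  case (Suc n)
  have body: "prog k ! fPower = If (Var 0) (Call fCross [Var 1, Call fPower [ERight (Var 0), Var 1]])
      (ENode ELeaf ELeaf)" by (simp add: prog_def)
  have IH: "evalb (prog k) [code_list (replicate n Leaf), code_maps xs] (prog k ! fPower)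
    (code_maps (concats n xs)) (t_power n M)" using Suc by simp
  have len: "length (concats n xs) \<le> M" using Suc.prems by simp
  show ?case unfolding body
    by (rule evalb_weaken, rule evalb_If_True, rule evalb_Var, simp, simp, simp,
        (rule IH evalb_cross[OF assms(1) len assms(2)] evalb_rules | simp)+)
      (simp add: t_power_def)
qed

lemma evalb_edge:
  assumes "small_tuple M t"
  shows "evalb (prog k) [code_tuple t] (prog k ! fEdge) (code_maps [zip (snd t) (snd t)]) (t_edge M)"
proof -
  have body: "prog k ! fEdge = ENode (Call fZip [ERight (Var 0), ERight (Var 0)]) ELeaf"
    by (simp add: prog_def)
  have t: "length (snd t) \<le> M" using assms by (simp add: small_tuple_def)
  show ?thesis unfolding body
    by (rule evalb_weaken, (rule evalb_zip_le[OF t] evalb_rules | simp add: code_tuple_def)+)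
      (simp_all add: t_edge_def)
qed

lemma evalb_edges:
  assumes "small_tuples M ts" "1 \<le> M"
  shows "evalb (prog k) [code_tups ts] (prog k ! fEdges) (code_maps (edges ts)) (t_edges M)"
proof -
  have body: "prog k ! fEdges = concat_loop fAppend fEdges fEdge 0"
    "prog k ! fAppend = append_body fAppend" by (simp_all add: prog_def)
  show ?thesis unfolding edges_def t_edges_def
    by (intro evalb_concat_map_loop[OF body _ _ _ _ _ evalb_edge])
      (use assms in \<open>simp_all add: small_tuples_def\<close>)
qed

lemma small_map_zip: "small_tuple M t \<Longrightarrow> small_tuple M u \<Longrightarrow> small_map M (zip (snd t) (snd u))"
  by (auto simp: small_tuple_def small_map_def dest: set_zip_leftD set_zip_rightD)

lemma evalb_fits:
  assumes "small_tuple M t" "small_tuple M u" "small_map M m"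
  shows "evalb (prog k) [code_tuple u, code_tuple t, code_map m] (prog k ! fFits)
    (code_bool (fits m t u)) (t_fits M)"
proof -
  have body: "prog k ! fFits = If (Call fEqual [ELeft (Var 1), ELeft (Var 0)])
      (If (Call fConflict [Call fZip [ERight (Var 1), ERight (Var 0)], Var 2]) ELeaf ETrue) ELeaf"
    by (simp add: prog_def)
  have t: "size (fst t) \<le> M" "length (snd t) \<le> M" using assms by (simp_all add: small_tuple_def)
  show ?thesis unfolding body
    by (rule evalb_weaken, (rule evalb_equal_le[OF t(1)] evalb_zip_le[OF t(2)]
          evalb_conflict[OF small_map_zip[OF assms(1,2)] assms(3)] evalb_rules
          | simp add: code_tuple_def)+)
      (auto simp: code_bool_def t_fits_def fits_def)
qed

lemma evalb_unfit:
  assumes "small_tuple M t" "small_tuples M us" "small_map M m"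
  shows "evalb (prog k) [code_tuple t, code_tups us, code_map m] (prog k ! fUnfit)
    (code_bool (\<not> (\<exists>u \<in> set us. fits m t u))) (t_unfit M)"
proof -
  have body: "prog k ! fUnfit = If (Call fSomeFits [Var 1, Var 0, Var 2]) ELeaf ETrue"
    "prog k ! fSomeFits = exists_loop fSomeFits fFits 2" by (simp_all add: prog_def)
  have *: "evalb (prog k) [code_tups us, code_tuple t, code_map m] (prog k ! fSomeFits)
    (code_bool (\<exists>u \<in> set us. fits m t u)) (loop_time M (t_fits M))"
    by (rule evalb_exists_loop[OF body(2) _ _ _ _ _ evalb_fits[OF assms(1) _ assms(3)]])
      (use assms(2) in \<open>simp_all add: small_tuples_def\<close>)
  show ?thesis unfolding body(1)
    by (rule evalb_weaken, (rule * evalb_rules | simp)+) (simp_all add: t_unfit_def code_bool_def)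
qed

lemma evalb_select_one:
  assumes "small_map M m" "small_tuples M ts" "small_tuples M us"
  shows "evalb (prog k) [code_map m, code_tups ts, code_tups us] (prog k ! fSelectOne)
    (code_maps (if projective ts us m then [m] else [])) (t_select_one M)"
proof -
  have body: "prog k ! fSelectOne = If (Call fConflict [Var 0, Var 0]) ELeaf
      (If (Call fSomeUnfit [Var 1, Var 2, Var 0]) ELeaf (ENode (Var 0) ELeaf))"
    "prog k ! fSomeUnfit = exists_loop fSomeUnfit fUnfit 2" by (simp_all add: prog_def)
  have *: "evalb (prog k) [code_tups ts, code_tups us, code_map m] (prog k ! fSomeUnfit)
    (code_bool (\<exists>t \<in> set ts. \<not> (\<exists>u \<in> set us. fits m t u))) (loop_time M (t_unfit M))"
    by (rule evalb_exists_loop[OF body(2) _ _ _ _ _ evalb_unfit[OF _ assms(3,1)]])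
      (use assms(2) in \<open>simp_all add: small_tuples_def\<close>)
  show ?thesis unfolding body(1)
    by (rule evalb_weaken, (rule * evalb_conflict[OF assms(1,1)] evalb_rules | simp)+)
      (auto simp: t_select_one_def projective_def)
qed

lemma evalb_select:
  assumes "small_maps M ms" "small_tuples M ts" "small_tuples M us" "1 \<le> M"
  shows "evalb (prog k) [code_maps ms, code_tups ts, code_tups us] (prog k ! fSelect)
    (code_maps (select ms ts us)) (t_select M)"
proof -
  have body: "prog k ! fSelect = concat_loop fAppend fSelect fSelectOne 2"
    "prog k ! fAppend = append_body fAppend" by (simp_all add: prog_def)
  show ?thesis unfolding select_def t_select_def
    by (rule evalb_concat_map_loop[OF body _ _ _ _ _ evalb_select_one[OF _ assms(2,3)]])
      (use assms in \<open>simp_all add: small_maps_def\<close>)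
qed

lemma evalb_agrees:
  assumes "small_map M m'" "small_map M W" "small_map M m"
  shows "evalb (prog k) [code_map m', code_map W, code_map m] (prog k ! fAgrees)
    (code_bool (agrees W m m')) (t_agrees M)"
proof -
  have body: "prog k ! fAgrees = If (Call fUncovered [Var 1, Var 0]) ELeaf
      (If (Call fUncovered [Var 0, Var 1]) ELeaf
        (If (Call fConflict [Var 0, Var 2]) ELeaf ETrue))" by (simp add: prog_def)
  show ?thesis unfolding body
    by (rule evalb_weaken, (rule evalb_uncovered[OF assms(2,1)] evalb_uncovered[OF assms(1,2)]
        evalb_conflict[OF assms(1,3)] evalb_rules | simp)+)
      (simp_all add: t_agrees_def agrees_def code_bool_def)
qed

lemma evalb_unsupported:
  assumes "small_map M W" "small_map M m" "small_maps M S"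
  shows "evalb (prog k) [code_map W, code_map m, code_maps S] (prog k ! fUnsupported)
    (code_bool (\<not> (\<exists>m' \<in> set S. agrees W m m'))) (t_unsupported M)"
proof -
  have body: "prog k ! fUnsupported = If (Call fSomeAgrees [Var 2, Var 0, Var 1]) ELeaf ETrue"
    "prog k ! fSomeAgrees = exists_loop fSomeAgrees fAgrees 2" by (simp_all add: prog_def)
  have *: "evalb (prog k) [code_maps S, code_map W, code_map m] (prog k ! fSomeAgrees)
    (code_bool (\<exists>m' \<in> set S. agrees W m m')) (loop_time M (t_agrees M))"
    by (rule evalb_exists_loop[OF body(2) _ _ _ _ _ evalb_agrees[OF _ assms(1,2)]])
      (use assms(3) in \<open>simp_all add: small_maps_def\<close>)
  show ?thesis unfolding body(1)
    by (rule evalb_weaken, (rule * evalb_rules | simp)+) (simp_all add: t_unsupported_def code_bool_def)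
qed

lemma evalb_keep:
  assumes "small_map M m" "small_maps M S" "small_maps M Ws"
  shows "evalb (prog k) [code_map m, code_maps S, code_maps Ws] (prog k ! fKeep)
    (code_maps (if unsupported S Ws m then [] else [m])) (t_keep M)"
proof -
  have body: "prog k ! fKeep = If (Call fSomeUnsupported [Var 2, Var 0, Var 1]) ELeaf (ENode (Var 0) ELeaf)"
    "prog k ! fSomeUnsupported = exists_loop fSomeUnsupported fUnsupported 2" by (simp_all add: prog_def)
  have *: "evalb (prog k) [code_maps Ws, code_map m, code_maps S] (prog k ! fSomeUnsupported)
    (code_bool (unsupported S Ws m)) (loop_time M (t_unsupported M))"
    unfolding unsupported_def
    by (rule evalb_exists_loop[OF body(2) _ _ _ _ _ evalb_unsupported[OF _ assms(1,2)]])
      (use assms(3) in \<open>simp_all add: small_maps_def\<close>)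
  show ?thesis unfolding body(1)
    by (rule evalb_weaken, (rule * evalb_rules | simp)+) (simp_all add: t_keep_def)
qed

lemma evalb_prune:
  assumes "small_maps M S" "small_maps M Ws" "1 \<le> M"
  shows "evalb (prog k) [code_maps S, code_maps S, code_maps Ws] (prog k ! fPrune)
    (code_maps (prune Ws S)) (t_prune M)"
proof -
  have body: "prog k ! fPrune = concat_loop fAppend fPrune fKeep 2"
    "prog k ! fAppend = append_body fAppend" by (simp_all add: prog_def)
  show ?thesis unfolding prune_def t_prune_def
    by (rule evalb_concat_map_loop[OF body _ _ _ _ _ evalb_keep[OF _ assms(1,2)]])
      (use assms in \<open>simp_all add: small_maps_def\<close>)
qed

text \<open>As a filter, a round of pruning preserves size bounds, and it either shortens the list
  or leaves it unchanged.\<close>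

lemma prune_eq_filter: "prune Ws S = filter (\<lambda>m. \<not> unsupported S Ws m) S"
proof -
  have "concat (map (\<lambda>m. if Q m then [] else [m]) xs) = filter (\<lambda>m. \<not> Q m) xs" for Q and xs :: "amap list"
    by (induction xs) auto
  then show ?thesis unfolding prune_def .
qed

lemma select_eq_filter: "select ms ts us = filter (projective ts us) ms"
  unfolding select_def by (induction ms) auto

lemma small_maps_filter: "small_maps M S \<Longrightarrow> small_maps M (filter Q S)"
  by (auto simp: small_maps_def intro: le_trans[OF length_filter_le])

text \<open>Only the length of \<open>xs\<close> enters: \<open>fRun\<close> passes the list of
  candidates as a unary counter of rounds.\<close>

lemma evalb_iterate:
  assumes "small_maps M S" "small_maps M Ws" "length xs \<le> M" "1 \<le> M"
  shows "evalb (prog k) [code_list xs, code_maps S, code_maps Ws] (prog k ! fIterate)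
    (code_maps ((prune Ws ^^ length xs) S)) (t_iterate M)"
proof -
  have body: "prog k ! fIterate = If (Var 0)
      (Call fIterate [ERight (Var 0), Call fPrune [Var 1, Var 1, Var 2], Var 2]) (Var 1)"
    by (simp add: prog_def)
  have *: "evalb (prog k) [code_list xs, code_maps S, code_maps Ws] (prog k ! fIterate)
    (code_maps ((prune Ws ^^ length xs) S)) (length xs * (t_prune M + 40) + 40)"
    using assms(1)
  proof (induction xs arbitrary: S)
    case Nil
    show ?case unfolding body
      by (rule evalb_weaken, rule evalb_If_False, (rule evalb_rules | simp)+)
  next
    case (Cons x xs)
    have IH: "evalb (prog k) [code_list xs, code_maps (prune Ws S), code_maps Ws] (prog k ! fIterate)
      (code_maps ((prune Ws ^^ length xs) (prune Ws S))) (length xs * (t_prune M + 40) + 40)"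
      using Cons.prems by (intro Cons.IH) (simp add: prune_eq_filter small_maps_filter)
    show ?case unfolding body
      by (rule evalb_weaken, rule evalb_If_True, rule evalb_Var, simp, simp, simp,
          (rule IH evalb_prune[OF Cons.prems assms(2,4)] evalb_rules | simp)+)
        (simp add: funpow_swap1, simp)
  qed
  show ?thesis unfolding t_iterate_def
    by (rule evalb_weaken[OF *]) (simp_all add: loop_time_mono assms(3))
qed

lemma evalb_run:
  assumes "small_maps M ms" "small_maps M Ws" "small_tuples M ts" "small_tuples M us" "1 \<le> M"
  shows "evalb (prog k) [code_maps ms, code_maps Ws, code_tups ts, code_tups us] (prog k ! fRun)
    (code_maps ((prune Ws ^^ length ms) (select ms ts us))) (t_run M)"
proof -
  have body: "prog k ! fRun = Call fIterate [Var 0, Call fSelect [Var 0, Var 2, Var 3], Var 1]"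
    by (simp add: prog_def)
  have "small_maps M (select ms ts us)" using assms(1) by (simp add: select_eq_filter small_maps_filter)
  moreover have "length ms \<le> M" using assms(1) by (simp add: small_maps_def)
  ultimately have *: "evalb (prog k) [code_maps ms, code_maps (select ms ts us), code_maps Ws] (prog k ! fIterate)
    (code_maps ((prune Ws ^^ length ms) (select ms ts us))) (t_iterate M)"
    using evalb_iterate[OF _ assms(2) _ assms(5), of "select ms ts us" "map code_map ms"] by simp
  show ?thesis unfolding body
    by (rule evalb_weaken, (rule * evalb_select[OF assms(1,3,4,5)] evalb_rules | simp)+)
      (simp add: t_run_def)
qed

lemma evalb_literal: "evalb P env (literal n) (code_list (replicate n Leaf)) (2 * n + 1)"
proof (induction n)
  case (Suc n)
  show ?case by (rule evalb_weaken, simp, rule evalb_ENode, rule evalb_ELeaf, rule Suc.IH) simp_all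
qed (use evalb_ELeaf in simp)

lemma evalb_solve:
  assumes "small_tuples M ts" "small_tuples M us" "1 \<le> M"
    and "small_maps M (matches ts us)" "small_maps M (edges ts)"
    and "\<And>j. j \<le> k \<Longrightarrow> small_maps M (concats j (matches ts us))"
    and "\<And>j. j \<le> k \<Longrightarrow> small_maps M (concats j (edges ts))"
  shows "evalb (prog k) [code_tups ts, code_tups us] (prog k ! fSolve) (code_maps (solve k ts us)) (t_solve k M)"
proof -
  have body: "prog k ! fSolve = If (Var 0)
      (Call fRun [Call fPower [literal k, Call fMatches [Var 0, Var 1]],
        Call fPower [literal k, Call fEdges [Var 0]], Var 0, Var 1])
      (ENode ELeaf ELeaf)" by (simp add: prog_def)
  show ?thesis
  proof (cases ts)
    case Nil
    show ?thesis unfolding body Nil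
      by (rule evalb_weaken, rule evalb_If_False, (rule evalb_rules | simp)+)
        (simp_all add: solve_def code_map_def t_solve_def)
  next
    case (Cons t ts')
    have ne: "code_tups ts \<noteq> Leaf" "ts \<noteq> []" using Cons by simp_all
    have 1: "evalb (prog k) [code_list (replicate k Leaf), code_maps (matches ts us)] (prog k ! fPower)
      (code_maps (concats k (matches ts us))) (t_power k M)"
      by (rule evalb_power[OF assms(4,3)]) (use assms(6) in \<open>simp add: small_maps_def\<close>)
    have 2: "evalb (prog k) [code_list (replicate k Leaf), code_maps (edges ts)] (prog k ! fPower)
      (code_maps (concats k (edges ts))) (t_power k M)"
      by (rule evalb_power[OF assms(5,3)]) (use assms(7) in \<open>simp add: small_maps_def\<close>)
    have len: "length us \<le> M" using assms(2) by (simp add: small_tuples_def)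
    note run = evalb_run[OF assms(6)[OF order_refl] assms(7)[OF order_refl] assms(1,2,3)]
    show ?thesis unfolding body
      by (rule evalb_weaken, rule evalb_If_True, rule evalb_Var, simp, simp, simp add: ne,
          (rule run 1 2 evalb_literal evalb_matches[OF assms(1) len assms(3)]
            evalb_edges[OF assms(1,3)] evalb_rules | simp)+)
        (simp_all add: solve_def t_solve_def ne Let_def)
  qed
qed

text \<open>The universe lists \<open>x\<close> and \<open>y\<close> are skipped: unions consist of
  elements of tuples of \<open>A\<close>, and the values of projective homomorphisms on them occur
  in tuples of \<open>B\<close>.\<close>

lemma evalb_main:
  assumes "evalb (prog k) [code_tups ts, code_tups us] (prog k ! fSolve) w c"
    and v: "v = Node (Node x (code_tups ts)) (Node y (code_tups us))"
  shows "evalb (prog k) [v] (Call fMain [Var 0]) w (c + 20)"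
proof -
  have body: "prog k ! fMain = Call fSolve [ERight (ELeft (Var 0)), ERight (ERight (Var 0))]"
    by (simp add: prog_def)
  have main: "evalb (prog k) [v] (prog k ! fMain) w (c + 10)"
    unfolding body v by (rule evalb_weaken, (rule assms(1)[unfolded One_nat_def] evalb_rules | simp)+)
  show ?thesis by (rule evalb_weaken, (rule main evalb_rules | simp)+)
qed

section \<open>What the program computes\<close>

lemma set_concats: "set (concats n xs) = {concat ms | ms. length ms = n \<and> set ms \<subseteq> set xs}"
proof (induction n)
  case (Suc n)
  have "set (concats (Suc n) xs) = {x @ y | x y. x \<in> set xs \<and> y \<in> set (concats n xs)}"
    by (auto simp: cross_def)
  also have "\<dots> = {concat ms | ms. length ms = Suc n \<and> set ms \<subseteq> set xs}"
  proof (intro equalityI subsetI)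
    fix m assume "m \<in> {x @ y | x y. x \<in> set xs \<and> y \<in> set (concats n xs)}"
    then obtain x ms where "m = x @ concat ms" "x \<in> set xs" "length ms = n" "set ms \<subseteq> set xs"
      unfolding Suc.IH by auto
    then show "m \<in> {concat ms | ms. length ms = Suc n \<and> set ms \<subseteq> set xs}"
      by (intro CollectI exI[of _ "x # ms"]) simp
  next
    fix m assume "m \<in> {concat ms | ms. length ms = Suc n \<and> set ms \<subseteq> set xs}"
    then obtain x ms where "m = concat (x # ms)" "length ms = n" "set (x # ms) \<subseteq> set xs"
      by (auto simp: length_Suc_conv)
    then show "m \<in> {x @ y | x y. x \<in> set xs \<and> y \<in> set (concats n xs)}"
      unfolding Suc.IH by auto
  qed
  finally show ?case .
qed simp

text \<open>Concatenating lists unites their key sets, so lists with hyperedges as key sets produce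
  unions of \<open>n\<close> hyperedges.\<close>

lemma keys_concats:
  "(\<lambda>m. fst ` set m) ` set (concats n xs) =
   {\<Union>(set es) | es. length es = n \<and> set es \<subseteq> (\<lambda>m. fst ` set m) ` set xs}" (is "?L = ?R")
proof (intro equalityI subsetI)
  fix X assume "X \<in> ?L"
  then obtain ms where "X = fst ` set (concat ms)" "length ms = n" "set ms \<subseteq> set xs"
    by (auto simp: set_concats)
  then show "X \<in> ?R"
    by (intro CollectI exI[of _ "map (\<lambda>m. fst ` set m) ms"]) auto
next
  fix X assume "X \<in> ?R"
  \<comment> \<open>Written as membership in \<open>lists\<close>, the inclusion lets
    \<open>lists_image\<close> choose preimages for all entries at once.\<close>
  then obtain es where es: "X = \<Union>(set es)" "length es = n" "es \<in> lists ((\<lambda>m. fst ` set m) ` set xs)"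
    by auto
  then obtain ms where ms: "es = map (\<lambda>m. fst ` set m) ms" "ms \<in> lists (set xs)"
    unfolding lists_image by auto
  have "concat ms \<in> set (concats n xs)" using ms es(2) by (auto simp: set_concats)
  moreover have "X = fst ` set (concat ms)" using es(1) ms(1) by auto
  ultimately show "X \<in> ?L" by (rule rev_image_eqI)
qed

lemma map_of_eqI:
  assumes "\<And>u b. (u, b) \<in> set m \<Longrightarrow> f u = Some b" "dom f \<subseteq> fst ` set m"
  shows "map_of m = f"
proof
  fix u
  show "map_of m u = f u"
  proof (cases "map_of m u")
    case None
    then have "u \<notin> fst ` set m" by (simp add: map_of_eq_None_iff)
    then have "u \<notin> dom f" using assms(2) by auto
    then show ?thesis using None by (simp add: domIff)
  next
    case (Some b)
    then show ?thesis using assms(1) map_of_SomeD by force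
  qed
qed

lemma conflict_iff:
  "conflict m' m \<longleftrightarrow> (\<exists>u b c. (u, b) \<in> set m' \<and> map_of m u = Some c \<and> b \<noteq> c)"
  by (simp add: conflict_def clash_def Bex_def split_paired_Ex)

lemma uncovered_iff: "uncovered m' m \<longleftrightarrow> \<not> fst ` set m' \<subseteq> dom (map_of m)"
  by (simp only: uncovered_def image_subset_iff domIff) simp

lemma consistent_map_of:
  assumes "\<not> conflict m m" "(u, b) \<in> set m"
  shows "map_of m u = Some b"
proof -
  have "u \<in> dom (map_of m)" unfolding dom_map_of_conv_image_fst using assms(2) by force
  then obtain c where c: "map_of m u = Some c" by auto
  then have "b = c" using assms unfolding conflict_iff by metis
  then show ?thesis using c by simp
qed

text \<open>The test \<open>conflict\<close> inspects all entries of \<open>m'\<close>, shadowed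
  ones included; consistency of \<open>m'\<close> turns it into a comparison of maps.\<close>

lemma agrees_iff:
  assumes "\<not> conflict m' m'"
  shows "agrees W m m' \<longleftrightarrow> dom (map_of m') = fst ` set W \<and>
    (\<forall>u \<in> dom (map_of m) \<inter> fst ` set W. map_of m u = map_of m' u)"
proof -
  have dom: "dom (map_of m') = fst ` set m'" by (rule dom_map_of_conv_image_fst)
  have "\<not> uncovered m' W \<longleftrightarrow> fst ` set m' \<subseteq> fst ` set W"
    by (simp add: uncovered_iff dom_map_of_conv_image_fst)
  moreover have "\<not> uncovered W m' \<longleftrightarrow> fst ` set W \<subseteq> fst ` set m'"
    by (simp add: uncovered_iff dom)
  moreover have "conflict m' m \<longleftrightarrow> (\<exists>u \<in> dom (map_of m) \<inter> fst ` set m'. map_of m u \<noteq> map_of m' u)"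
  proof
    assume "conflict m' m"
    then obtain u b c where "(u, b) \<in> set m'" "map_of m u = Some c" "b \<noteq> c"
      unfolding conflict_iff by metis
    moreover from this have "map_of m' u = Some b" using consistent_map_of[OF assms] by simp
    ultimately show "\<exists>u \<in> dom (map_of m) \<inter> fst ` set m'. map_of m u \<noteq> map_of m' u"
      by (intro bexI[of _ u]) force+
  next
    assume "\<exists>u \<in> dom (map_of m) \<inter> fst ` set m'. map_of m u \<noteq> map_of m' u"
    then obtain u where u: "u \<in> dom (map_of m)" "u \<in> dom (map_of m')" "map_of m u \<noteq> map_of m' u"
      unfolding dom[symmetric] by (elim bexE IntE) (rule that)
    then obtain b c where bc: "map_of m' u = Some b" "map_of m u = Some c"
      by (auto simp only: dom_def)
    have "(u, b) \<in> set m'" using bc(1) by (rule map_of_SomeD)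
    then show "conflict m' m" unfolding conflict_iff using bc u(3) by (metis option.inject)
  qed
  ultimately have "agrees W m m' \<longleftrightarrow> fst ` set m' = fst ` set W \<and>
      \<not> (\<exists>u \<in> dom (map_of m) \<inter> fst ` set m'. map_of m u \<noteq> map_of m' u)"
    unfolding agrees_def by (simp only: set_eq_subset) argo
  then show ?thesis unfolding dom by (cases "fst ` set m' = fst ` set W") simp_all
qed

text \<open>A round that changes the list shortens it, so at most \<open>length S\<close> rounds can
  change anything. The filter condition may depend on the current list.\<close>

lemma filter_iterate_fixpoint:
  assumes f: "\<And>S. f S = filter (Q S) S" and "length S \<le> n"
  shows "f ((f ^^ n) S) = (f ^^ n) S"
  using assms(2)
proof (induction n arbitrary: S)
  case 0
  then show ?case using f[of "[]"] by simp
next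
  case (Suc n)
  show ?case
  proof (cases "f S = S")
    case True
    have "(f ^^ j) S = S" for j by (induction j) (simp_all add: True)
    then show ?thesis by (metis True)
  next
    case False
    then have "length (f S) < length S"
      unfolding f by (metis filter_id_conv le_neq_implies_less length_filter_le length_filter_less)
    then have "f ((f ^^ n) (f S)) = (f ^^ n) (f S)" using Suc by simp
    then show ?thesis by (simp add: funpow_swap1)
  qed
qed

section \<open>Candidates, unions and pruning for a coded instance\<close>

locale coded_csp = csp k A B
  for k :: nat and A :: "(data, data) rel_struct" and B :: "(data, data) rel_struct" +
  fixes ts us :: "tuple list"
  assumes set_ts: "set ts = {(R, as). as \<in> rels A R}"
    and set_us: "set us = {(R, bs). bs \<in> rels B R}"
begin

lemma hyperedges_ts: "hyperedges A = (\<lambda>t. set (snd t)) ` set ts"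
  unfolding hyperedges_def set_ts by force

lemma mem_matches:
  "m \<in> set (matches ts us) \<longleftrightarrow> (\<exists>R as bs. as \<in> rels A R \<and> bs \<in> rels B R \<and> m = zip as bs)"
proof -
  have "m \<in> set (matches ts us) \<longleftrightarrow>
      (\<exists>t \<in> set ts. \<exists>u \<in> set us. fst t = fst u \<and> m = zip (snd t) (snd u))"
    by (auto simp: matches_def)
  then show ?thesis unfolding set_ts set_us by (auto simp: Bex_def)
qed

text \<open>The inclusion can be strict: a tuple of \<open>A\<close> whose symbol has no tuple in
  \<open>B\<close> yields no pairing. The program therefore takes its unions from
  \<open>edges\<close>.\<close>

lemma keys_matches: "(\<lambda>m. fst ` set m) ` set (matches ts us) \<subseteq> hyperedges A"
proof
  fix X assume "X \<in> (\<lambda>m. fst ` set m) ` set (matches ts us)"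
  then obtain R as bs where "as \<in> rels A R" "bs \<in> rels B R" "X = fst ` set (zip as bs)"
    using mem_matches by auto
  moreover from this have "X = set as"
    using length_rels map_fst_zip by (metis list.set_map)
  ultimately show "X \<in> hyperedges A" unfolding hyperedges_def by auto
qed

lemma keys_edges: "(\<lambda>m. fst ` set m) ` set (edges ts) = hyperedges A"
proof -
  have "fst ` set (zip as as) = set as" for as :: "data list"
    using map_fst_zip by (metis list.set_map)
  then show ?thesis unfolding edges_def hyperedges_ts by (simp add: image_image)
qed

context
  assumes ts: "ts \<noteq> []"
begin

lemma unions_eq: "unions = {\<Union>(set es) | es. length es = k \<and> set es \<subseteq> hyperedges A}"
  unfolding k_unions_def using ts by (simp add: hyperedges_ts)

lemma keys_concats_edges: "(\<lambda>m. fst ` set m) ` set (concats k (edges ts)) = unions"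
  unfolding keys_concats keys_edges unions_eq ..

lemma keys_concats_matches: "m \<in> set (concats k (matches ts us)) \<Longrightarrow> fst ` set m \<in> unions"
proof -
  assume "m \<in> set (concats k (matches ts us))"
  then have "fst ` set m \<in> (\<lambda>m. fst ` set m) ` set (concats k (matches ts us))" by (rule imageI)
  then obtain es where es: "fst ` set m = \<Union>(set es)" "length es = k"
    "set es \<subseteq> (\<lambda>m. fst ` set m) ` set (matches ts us)"
    unfolding keys_concats by auto
  have "set es \<subseteq> hyperedges A" using es(3) keys_matches by (rule subset_trans)
  then show "fst ` set m \<in> unions" unfolding unions_eq using es(1,2) by (intro CollectI exI[of _ es] conjI)
qed

lemma values_concats_matches: "m \<in> set (concats k (matches ts us)) \<Longrightarrow> snd ` set m \<subseteq> univ B"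
proof -
  assume "m \<in> set (concats k (matches ts us))"
  then obtain ms where "m = concat ms" and ms: "set ms \<subseteq> set (matches ts us)" by (auto simp: set_concats)
  moreover have "snd ` set m' \<subseteq> univ B" if m': "m' \<in> set ms" for m'
  proof -
    have "m' \<in> set (matches ts us)" using ms m' by auto
    then obtain R as bs where "bs \<in> rels B R" "m' = zip as bs" unfolding mem_matches by auto
    then show ?thesis using rels_B[of bs R] by (auto dest: set_zip_rightD)
  qed
  ultimately show "snd ` set m \<subseteq> univ B" by auto
qed

lemma fits_iff:
  assumes "as \<in> rels A R"
  shows "(\<exists>u \<in> set us. fits m (R, as) u) \<longleftrightarrow>
    (\<exists>bs \<in> rels B R. \<forall>i < length as. as ! i \<in> dom (map_of m) \<longrightarrow> map_of m (as ! i) = Some (bs ! i))"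
proof -
  have "\<not> conflict (zip as bs) m \<longleftrightarrow>
      (\<forall>i < length as. as ! i \<in> dom (map_of m) \<longrightarrow> map_of m (as ! i) = Some (bs ! i))"
    if "bs \<in> rels B R" for bs
  proof -
    have "length as = length bs" using length_rels assms that .
    then show ?thesis unfolding conflict_iff by (auto simp: in_set_zip)
  qed
  then show ?thesis unfolding fits_def using set_us by auto
qed

lemma projective_iff:
  assumes "dom (map_of m) \<subseteq> univ A" "ran (map_of m) \<subseteq> univ B"
  shows "projective ts us m \<longleftrightarrow> \<not> conflict m m \<and> projective_homomorphism A B (map_of m)"
proof -
  have "(\<forall>t \<in> set ts. \<exists>u \<in> set us. fits m t u) \<longleftrightarrow>
      (\<forall>R. \<forall>as \<in> rels A R. \<exists>u \<in> set us. fits m (R, as) u)"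
    by (auto simp: set_ts)
  then show ?thesis unfolding projective_def projective_homomorphism_def
    using assms by (simp add: fits_iff)
qed

lemma map_of_select: "map_of ` set (select (concats k (matches ts us)) ts us) = initial_maps"
proof (intro equalityI subsetI)
  fix f assume "f \<in> map_of ` set (select (concats k (matches ts us)) ts us)"
  then obtain m where m: "f = map_of m" "m \<in> set (concats k (matches ts us))" "projective ts us m"
    by (auto simp: select_eq_filter)
  have "dom f \<in> unions" unfolding m(1) dom_map_of_conv_image_fst by (rule keys_concats_matches[OF m(2)])
  moreover have "ran f \<subseteq> univ B"
  proof
    fix b assume "b \<in> ran f"
    then obtain u where "(u, b) \<in> set m" unfolding m(1) ran_def using map_of_SomeD by fastforce
    then have "b \<in> snd ` set m" by force
    then show "b \<in> univ B" using values_concats_matches[OF m(2)] by auto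
  qed
  ultimately show "f \<in> initial_maps"
    unfolding initial_maps_def using projective_iff[of m] m(1,3) unions_subset by simp
next
  fix f assume f: "f \<in> initial_maps"
  then have phf: "projective_homomorphism A B f" and "dom f \<in> unions" by (simp_all add: initial_maps_def)
  then obtain es where es: "dom f = \<Union>(set es)" "length es = k" and "set es \<subseteq> hyperedges A"
    unfolding unions_eq by (elim CollectE exE conjE) (rule that)
  then have "es \<in> lists (hyperedges A)" by auto
  then obtain tl where tl: "es = map (\<lambda>t. set (snd t)) tl" "tl \<in> lists (set ts)"
    unfolding hyperedges_ts lists_image by auto
  \<comment> \<open>The candidate for \<open>f\<close> pairs each of the \<open>k\<close> tuples
    behind \<open>dom f\<close> with its image under \<open>f\<close>. The image is a tuple of
    \<open>B\<close> by projectivity, as \<open>f\<close> is defined on all entries.\<close>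
  let ?z = "\<lambda>t. zip (snd t) (map (the \<circ> f) (snd t))"
  let ?m = "concat (map ?z tl)"
  have z: "?z t \<in> set (matches ts us)" if t: "t \<in> set tl" for t
  proof -
    obtain R as where Ras: "t = (R, as)" "as \<in> rels A R" using t tl(2) set_ts by fastforce
    then obtain bs where bs: "bs \<in> rels B R"
      "\<And>i. i < length as \<Longrightarrow> as ! i \<in> dom f \<Longrightarrow> f (as ! i) = Some (bs ! i)"
      using phf unfolding projective_homomorphism_def by metis
    have "set as \<subseteq> dom f" using es(1) tl(1) t Ras(1) by auto
    then have "f (as ! i) = Some (bs ! i)" if "i < length as" for i
      using bs(2)[OF that] nth_mem[OF that] by auto
    then have "map (the \<circ> f) as = bs"
      using length_rels[OF Ras(2) bs(1)] by (intro nth_equalityI) simp_all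
    then show ?thesis unfolding mem_matches using Ras bs(1) by auto
  qed
  have mf: "f u = Some b" if "(u, b) \<in> set ?m" for u b
  proof -
    from that have "u \<in> dom f" "b = the (f u)"
      using es(1) tl(1) by (auto simp: zip_map2 dest: set_zip_leftD) (auto simp: in_set_zip)
    then show ?thesis by auto
  qed
  have "fst ` set (?z t) = set (snd t)" for t :: tuple
    using map_fst_zip[of "snd t" "map (the \<circ> f) (snd t)"] by (metis length_map list.set_map)
  then have "dom f \<subseteq> fst ` set ?m" using es(1) tl(1) by (simp add: image_UN)
  then have m: "map_of ?m = f" using mf by (intro map_of_eqI)
  have "\<not> conflict ?m ?m" unfolding conflict_iff m using mf by force
  moreover have "dom f \<subseteq> univ A" "ran f \<subseteq> univ B"
    using phf by (simp_all add: projective_homomorphism_def)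
  ultimately have "projective ts us ?m" using projective_iff[of ?m] phf m by simp
  moreover have "?m \<in> set (concats k (matches ts us))"
    unfolding set_concats using z es(2) tl(1) by (intro CollectI exI[of _ "map ?z tl"]) auto
  ultimately have "?m \<in> set (select (concats k (matches ts us)) ts us)" by (simp add: select_eq_filter)
  then show "f \<in> map_of ` set (select (concats k (matches ts us)) ts us)" using m by (intro image_eqI) simp_all
qed

lemma unsupported_iff:
  assumes "\<And>m'. m' \<in> set S \<Longrightarrow> \<not> conflict m' m'"
  shows "unsupported S (concats k (edges ts)) m \<longleftrightarrow> \<not> supported (map_of ` set S) (map_of m)"
proof -
  have "supported (map_of ` set S) (map_of m) \<longleftrightarrow>
      (\<forall>W \<in> set (concats k (edges ts)). \<exists>m' \<in> set S. dom (map_of m') = fst ` set W \<and>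
        (\<forall>u \<in> dom (map_of m) \<inter> fst ` set W. map_of m u = map_of m' u))"
    unfolding supported_def keys_concats_edges[symmetric] by simp
  also have "\<dots> \<longleftrightarrow> (\<forall>W \<in> set (concats k (edges ts)). \<exists>m' \<in> set S. agrees W m m')"
    using agrees_iff[OF assms] by (intro ball_cong bex_cong refl) simp
  finally show ?thesis unfolding unsupported_def by simp
qed

end

lemma solve_correct:
  "\<exists>H. remove_step\<^sup>*\<^sup>* initial_maps H \<and> (\<forall>f \<in> H. supported H f) \<and> map_of ` set (solve k ts us) = H"
proof (cases "ts = []")
  case True
  then have no_rels: "as \<notin> rels A R" for as R using set_ts by auto
  have un: "unions = {{}}" using True by (simp add: k_unions_def hyperedges_ts)
  have "initial_maps = {Map.empty}"
    unfolding initial_maps_def un by (auto simp: projective_homomorphism_def no_rels)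
  moreover have "supported {Map.empty} Map.empty" unfolding supported_def un by simp
  ultimately show ?thesis using True by (intro exI[of _ initial_maps]) (simp add: solve_def)
next
  case False
  let ?Ws = "concats k (edges ts)" and ?ms = "concats k (matches ts us)"
  let ?S = "\<lambda>n. (prune ?Ws ^^ n) (select ?ms ts us)"
  have consistent: "\<not> conflict m m" if "m \<in> set (?S n)" for m n
    using that by (induction n) (auto simp: prune_eq_filter select_eq_filter projective_def)
  have unsupp: "unsupported (?S n) ?Ws m \<longleftrightarrow> \<not> supported (map_of ` set (?S n)) (map_of m)" for m n
    by (rule unsupported_iff[OF False consistent])
  have prune: "set (prune ?Ws (?S n)) = {m \<in> set (?S n). supported (map_of ` set (?S n)) (map_of m)}" for n
    by (simp only: prune_eq_filter[of ?Ws "?S n"] set_filter unsupp not_not)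
  have steps: "remove_step\<^sup>*\<^sup>* initial_maps (map_of ` set (?S n))" for n
  proof (induction n)
    case 0
    then show ?case using map_of_select[OF False] by simp
  next
    case (Suc n)
    let ?H = "map_of ` set (?S n)"
    \<comment> \<open>Several lists may stand for one map. They are kept or deleted together, as
      support depends on the map alone.\<close>
    have "map_of ` set (?S (Suc n)) = {f \<in> ?H. supported ?H f}" using prune[of n] by auto
    moreover have "remove_step\<^sup>*\<^sup>* ?H {f \<in> ?H. supported ?H f}" by (rule remove_unsupported) simp
    ultimately have "remove_step\<^sup>*\<^sup>* ?H (map_of ` set (?S (Suc n)))" by (simp only:)
    then show ?case by (rule rtranclp_trans[OF Suc])
  qed
  \<comment> \<open>Selection only shortens the list of candidates, so the number of candidates is a
    sufficient number of rounds.\<close>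
  have fixpoint: "prune ?Ws (?S (length ?ms)) = ?S (length ?ms)"
    by (rule filter_iterate_fixpoint[OF prune_eq_filter]) (simp add: select_eq_filter)
  have "supported (map_of ` set (?S (length ?ms))) f" if "f \<in> map_of ` set (?S (length ?ms))" for f
    using prune[of "length ?ms"] that unfolding fixpoint by auto
  then show ?thesis using steps[of "length ?ms"] False by (simp add: solve_def Let_def)
qed

end

section \<open>Polynomial running time\<close>

text \<open>Equality with a polynomial, in place of a bound by one, makes closure under composition
  immediate.\<close>

definition poly_fun :: "(nat \<Rightarrow> nat) \<Rightarrow> bool" where
  "poly_fun f \<longleftrightarrow> (\<exists>q. \<forall>n. f n = poly q n)"

lemma poly_fun_const: "poly_fun (\<lambda>n. c)"
  unfolding poly_fun_def by (rule exI[of _ "[:c:]"]) simp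

lemma poly_fun_id: "poly_fun (\<lambda>n. n)"
  unfolding poly_fun_def by (rule exI[of _ "[:0, 1:]"]) simp

lemma poly_fun_add: "poly_fun f \<Longrightarrow> poly_fun g \<Longrightarrow> poly_fun (\<lambda>n. f n + g n)"
  unfolding poly_fun_def by (metis poly_add)

lemma poly_fun_mult: "poly_fun f \<Longrightarrow> poly_fun g \<Longrightarrow> poly_fun (\<lambda>n. f n * g n)"
  unfolding poly_fun_def by (metis poly_mult)

lemma poly_fun_power: "poly_fun f \<Longrightarrow> poly_fun (\<lambda>n. f n ^ d)"
  unfolding poly_fun_def by (metis poly_power)

lemma poly_fun_compose: "poly_fun f \<Longrightarrow> poly_fun g \<Longrightarrow> poly_fun (\<lambda>n. f (g n))"
  unfolding poly_fun_def by (metis poly_pcompose)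

lemmas poly_fun_intros = poly_fun_const poly_fun_id poly_fun_add poly_fun_mult poly_fun_power

lemma poly_fun_t_solve: "poly_fun (t_solve k)"
proof -
  have "poly_fun (\<lambda>M. t_solve k M)"
    unfolding t_solve_def t_run_def t_iterate_def t_prune_def t_keep_def t_unsupported_def t_agrees_def
      t_select_def t_select_one_def t_unfit_def t_fits_def t_edges_def t_edge_def t_power_def t_cross_def
      t_join_all_def t_join_def t_matches_def t_match_a_def t_match_one_def t_uncovered_def t_missing_def
      t_conflict_def t_clash_def t_lookup_def t_zip_def t_equal_def loop_time_def
    by (intro poly_fun_intros)
  then show ?thesis .
qed

text \<open>If \<open>N\<close> bounds both tuple lists, there are at most
  \<open>(N + 1) ^ 2\<close> pairings and \<open>(N + 1) ^ (2 * j)\<close> concatenations of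
  \<open>j\<close> of them. The factor \<open>k + 1\<close> absorbs the length \<open>j * N\<close>
  of a concatenation, and the 2 in the exponent leaves room for the pairings even if
  \<open>k = 0\<close>.\<close>

definition size_bound :: "nat \<Rightarrow> nat \<Rightarrow> nat" where
  "size_bound k N = (k + 1) * (N + 1) ^ (2 * k + 2)"

lemma poly_fun_size_bound: "poly_fun (size_bound k)"
proof -
  have "poly_fun (\<lambda>N. size_bound k N)" unfolding size_bound_def by (intro poly_fun_intros)
  then show ?thesis .
qed

lemma le_size_bound:
  assumes "j \<le> k" "i \<le> 2 * k + 2"
  shows "(N + 1) ^ i \<le> size_bound k N" and "j * N \<le> size_bound k N" and "N \<le> size_bound k N"
    and "1 \<le> size_bound k N"
proof -
  have pow: "(N + 1) ^ i \<le> size_bound k N" if "i \<le> 2 * k + 2" for i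
  proof -
    have "1 * (N + 1) ^ i \<le> (k + 1) * (N + 1) ^ (2 * k + 2)"
      by (intro mult_mono power_increasing that) simp_all
    then show ?thesis by (simp add: size_bound_def)
  qed
  show "(N + 1) ^ i \<le> size_bound k N" by (rule pow[OF assms(2)])
  show "N \<le> size_bound k N" using pow[of 1] by simp
  show "1 \<le> size_bound k N" using pow[of 0] by simp
  have "(N + 1) ^ 1 \<le> (N + 1) ^ (2 * k + 2)" by (rule power_increasing) simp_all
  then have "j * N \<le> (k + 1) * (N + 1) ^ (2 * k + 2)"
    using assms(1) by (intro mult_mono) simp_all
  then show "j * N \<le> size_bound k N" by (simp add: size_bound_def)
qed

lemma length_cross: "length (cross xs ys) = length xs * length ys"
  unfolding cross_def by (induction xs) (simp_all add: length_concat comp_def sum_list_triv)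

lemma length_concats: "length (concats n xs) = length xs ^ n"
  by (induction n) (simp_all add: length_cross)

lemma length_concat_le:
  "(\<And>x. x \<in> set xs \<Longrightarrow> length (f x) \<le> c) \<Longrightarrow> length (concat (map f xs)) \<le> length xs * c"
proof (induction xs)
  case (Cons x xs)
  then have "length (f x) \<le> c" "length (concat (map f xs)) \<le> length xs * c" by simp_all
  then show ?case by simp
qed simp

lemma length_matches: "length (matches ts us) \<le> length ts * length us"
  unfolding matches_def by (intro length_concat_le length_concat_map_le) simp

lemma length_edges: "length (edges ts) = length ts"
  unfolding edges_def by (induction ts) simp_all

lemma small_maps_concats:
  assumes "\<And>m. m \<in> set xs \<Longrightarrow> small_map N m" "length xs \<le> (N + 1) ^ 2" "j \<le> k"
  shows "small_maps (size_bound k N) (concats j xs)"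
proof -
  have "length (concats j xs) \<le> ((N + 1) ^ 2) ^ j"
    unfolding length_concats using assms(2) by (rule power_mono) simp
  also have "\<dots> = (N + 1) ^ (2 * j)" by (simp only: power_mult)
  also have "\<dots> \<le> size_bound k N" by (rule le_size_bound) (use assms(3) in simp_all)
  finally have len: "length (concats j xs) \<le> size_bound k N" .
  have "length m \<le> j * N \<and> (\<forall>p \<in> set m. size (fst p) \<le> N \<and> size (snd p) \<le> N)"
    if "m \<in> set (concats j xs)" for m
    using that
  proof (induction j arbitrary: m)
    case (Suc j)
    then obtain x y where m: "m = x @ y" "x \<in> set xs" "y \<in> set (concats j xs)"
      by (auto simp: cross_def)
    then show ?case using Suc.IH[OF m(3)] assms(1)[OF m(2)] by (auto simp: small_map_def)
  qed simp
  then have "small_map (size_bound k N) m" if "m \<in> set (concats j xs)" for m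
    using that le_size_bound(2)[OF assms(3) le0, of N] le_size_bound(3)[OF assms(3) le0, of N]
    unfolding small_map_def by (meson le_trans)
  then show ?thesis using len by (simp add: small_maps_def)
qed

lemma small_map_mono: "small_map N m \<Longrightarrow> N \<le> M \<Longrightarrow> small_map M m"
  unfolding small_map_def by (meson le_trans)

lemma small_tuple_mono: "small_tuple N t \<Longrightarrow> N \<le> M \<Longrightarrow> small_tuple M t"
  unfolding small_tuple_def by (meson le_trans)

lemma small_tuples_mono: "small_tuples N ts \<Longrightarrow> N \<le> M \<Longrightarrow> small_tuples M ts"
  unfolding small_tuples_def by (meson le_trans small_tuple_mono)

lemma evalb_solve_size_bound:
  assumes "small_tuples N ts" "small_tuples N us"
  shows "evalb (prog k) [code_tups ts, code_tups us] (prog k ! fSolve) (code_maps (solve k ts us))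
    (t_solve k (size_bound k N))"
proof (rule evalb_solve)
  let ?M = "size_bound k N"
  note bound = le_size_bound[where j = k and k = k and N = N, OF order_refl le0]
  show "small_tuples ?M ts" "small_tuples ?M us"
    using assms bound(3) by (auto intro: small_tuples_mono)
  show "1 \<le> ?M" by (rule bound(4))
  have "length ts \<le> N" "length us \<le> N" using assms by (simp_all add: small_tuples_def)
  then have "length ts * length us \<le> (N + 1) * (N + 1)" by (intro mult_mono) simp_all
  then have lm: "length (matches ts us) \<le> (N + 1) ^ 2"
    using length_matches[of ts us] unfolding power2_eq_square by linarith
  have le: "length (edges ts) \<le> (N + 1) ^ 2"
    using \<open>length ts \<le> N\<close> by (simp add: length_edges power2_eq_square)
  have sm: "small_map N m" if "m \<in> set (matches ts us)" for m
  proof -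
    have "\<exists>t \<in> set ts. \<exists>u \<in> set us. m = zip (snd t) (snd u)"
      using that by (auto simp: matches_def split: if_splits)
    then show ?thesis using assms small_map_zip unfolding small_tuples_def by metis
  qed
  have se: "small_map N m" if "m \<in> set (edges ts)" for m
    using that assms(1) small_map_zip by (auto simp: edges_def small_tuples_def)
  have sq: "(N + 1) ^ 2 \<le> ?M" by (rule le_size_bound(1)[OF order_refl]) simp
  show "small_maps ?M (matches ts us)" "small_maps ?M (edges ts)"
    using le_trans[OF lm sq] le_trans[OF le sq] small_map_mono[OF sm bound(3)] small_map_mono[OF se bound(3)]
    by (simp_all add: small_maps_def)
  show "small_maps ?M (concats j (matches ts us))" if "j \<le> k" for j
    by (rule small_maps_concats[OF sm lm that])
  show "small_maps ?M (concats j (edges ts))" if "j \<le> k" for j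
    by (rule small_maps_concats[OF se le that])
qed

lemma length_le_size_code_list: "length xs \<le> size (code_list xs)"
  by (induction xs) simp_all

lemma size_le_size_code_list: "x \<in> set xs \<Longrightarrow> size x \<le> size (code_list xs)"
  by (induction xs) auto

lemma small_tuples_size: "small_tuples (size (code_tups ts)) ts"
proof -
  have "small_tuple (size (code_tups ts)) t" if t: "t \<in> set ts" for t
  proof -
    have c: "size (code_tuple t) \<le> size (code_tups ts)" by (rule size_le_size_code_list) (use t in simp)
    have "size x \<le> size (code_tups ts)" if "x \<in> set (snd t)" for x
      using size_le_size_code_list[OF that] c by (simp add: code_tuple_def)
    moreover have "length (snd t) \<le> size (code_tups ts)"
      using length_le_size_code_list[of "snd t"] c by (simp add: code_tuple_def)
    moreover have "size (fst t) \<le> size (code_tups ts)" using c by (simp add: code_tuple_def)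
    ultimately show ?thesis by (simp add: small_tuple_def)
  qed
  then show ?thesis using length_le_size_code_list[of "map code_tuple ts"] by (simp add: small_tuples_def)
qed

lemma codes_structureE:
  assumes "codes_structure A v"
  obtains x ts where "v = Node x (code_tups ts)" "set ts = {(R, as). as \<in> rels A R}"
proof -
  have "(\<lambda>(R, as). Node R (code_list as)) = code_tuple" by (auto simp: code_tuple_def)
  then show ?thesis using assms that unfolding codes_structure_def by metis
qed

lemma prog_correct:
  assumes "csp_instance A B" "codes_instance A B v"
  shows "\<exists>w n B'. runs (prog k) v w n \<and> n \<le> t_solve k (size_bound k (size v)) + 20 \<and>
    pkc_result k A B B' \<and> codes_tuples B' w \<and> (w = Leaf \<longleftrightarrow> reports_inconsistency B')"
proof -
  obtain v\<^sub>A v\<^sub>B where v: "codes_structure A v\<^sub>A" "codes_structure B v\<^sub>B" "v = Node v\<^sub>A v\<^sub>B"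
    using assms(2) unfolding codes_instance_def by auto
  obtain x ts where ts: "v\<^sub>A = Node x (code_tups ts)" "set ts = {(R, as). as \<in> rels A R}"
    by (rule codes_structureE[OF v(1)])
  obtain y us where us: "v\<^sub>B = Node y (code_tups us)" "set us = {(R, bs). bs \<in> rels B R}"
    by (rule codes_structureE[OF v(2)])
  interpret coded_csp k A B ts us
    by unfold_locales (use assms(1) ts(2) us(2) in simp_all)
  let ?S = "solve k ts us"
  let ?w = "code_maps ?S"
  have v_eq: "v = Node (Node x (code_tups ts)) (Node y (code_tups us))"
    using v(3) ts(1) us(1) by simp
  have "small_tuples (size v) ts" "small_tuples (size v) us"
    by (rule small_tuples_mono[OF small_tuples_size]; simp add: v_eq)+
  then have "evalb (prog k) [v] (Call fMain [Var 0]) ?w (t_solve k (size_bound k (size v)) + 20)"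
    by (intro evalb_main[OF evalb_solve_size_bound v_eq])
  then obtain n where n: "runs (prog k) v ?w n" "n \<le> t_solve k (size_bound k (size v)) + 20"
    unfolding evalb_def runs_def by auto
  obtain H where H: "remove_step\<^sup>*\<^sup>* initial_maps H" "\<forall>f \<in> H. supported H f" "map_of ` set ?S = H"
    using solve_correct by auto
  note sub = remove_steps_subset[OF H(1)]
  \<comment> \<open>Of the many possible orders of removal, this run follows the rounds of the
    program.\<close>
  have "pkc_result k A B (struct_of H)" unfolding pkc_result_iff using H(1,2) by auto
  moreover have "codes_tuples (struct_of H) ?w"
  proof -
    have "code_map = (\<lambda>m. code_list (map (\<lambda>(u, b). Node u b) m))"
      by (auto simp: code_map_def code_pair_def fun_eq_iff intro!: arg_cong[of _ _ code_list])
    then show ?thesis unfolding codes_tuples_def tuple_maps_struct_of[OF sub]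
      by (intro exI[of _ ?S]) (simp add: H(3))
  qed
  moreover have "?w = Leaf \<longleftrightarrow> reports_inconsistency (struct_of H)"
    using H(3) unfolding reports_inconsistency_struct_of[OF sub] by (cases ?S) auto
  ultimately show ?thesis using n by (intro exI conjI)
qed

theorem theorem8:
  fixes k :: nat
  assumes "k \<ge> 1"
  shows "(\<exists>(P :: program) (q :: nat poly). \<forall>A B v.
            csp_instance A B \<and> codes_instance A B v \<longrightarrow>
            (\<exists>w n B'.
               runs P v w n \<and> n \<le> poly q (size v) \<and>
               pkc_result k A B B' \<and> codes_tuples B' w \<and>
               (w = Leaf \<longleftrightarrow> reports_inconsistency B') \<and>
               (csp_coverwidth_instance k A B \<longrightarrow> (w = Leaf \<longleftrightarrow> \<not> satisfiable A B))))
       \<and> (\<forall>(A :: ('s, 'a) rel_struct) (B :: ('s, 'b) rel_struct).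
            csp_coverwidth_instance k A B \<longrightarrow>
            (\<exists>B'. pkc_result k A B B') \<and>
            (\<forall>B'. pkc_result k A B B' \<longrightarrow>
               (reports_inconsistency B' \<longleftrightarrow> \<not> satisfiable A B)))"
proof (intro conjI allI impI)
  have "poly_fun (\<lambda>N. t_solve k (size_bound k N) + 20)"
    by (intro poly_fun_intros poly_fun_compose[OF poly_fun_t_solve poly_fun_size_bound])
  then obtain q where q: "\<And>N. t_solve k (size_bound k N) + 20 = poly q N"
    unfolding poly_fun_def by auto
  show "\<exists>(P :: program) (q :: nat poly). \<forall>A B v.
            csp_instance A B \<and> codes_instance A B v \<longrightarrow>
            (\<exists>w n B'.
               runs P v w n \<and> n \<le> poly q (size v) \<and>
               pkc_result k A B B' \<and> codes_tuples B' w \<and>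
               (w = Leaf \<longleftrightarrow> reports_inconsistency B') \<and>
               (csp_coverwidth_instance k A B \<longrightarrow> (w = Leaf \<longleftrightarrow> \<not> satisfiable A B)))"
  proof (rule exI[of _ "prog k"], rule exI[of _ q], intro allI impI)
    fix A B v
    assume "csp_instance A B \<and> codes_instance A B v"
    then obtain w n B' where "runs (prog k) v w n" "n \<le> poly q (size v)" "pkc_result k A B B'"
      "codes_tuples B' w" "w = Leaf \<longleftrightarrow> reports_inconsistency B'"
      using prog_correct[of A B v k] unfolding q by metis
    then show "\<exists>w n B'. runs (prog k) v w n \<and> n \<le> poly q (size v) \<and>
               pkc_result k A B B' \<and> codes_tuples B' w \<and>
               (w = Leaf \<longleftrightarrow> reports_inconsistency B') \<and>
               (csp_coverwidth_instance k A B \<longrightarrow> (w = Leaf \<longleftrightarrow> \<not> satisfiable A B))"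
      using pkc_result_correct by metis
  qed
next
  fix A :: "('s, 'a) rel_struct" and B :: "('s, 'b) rel_struct"
  assume inst: "csp_coverwidth_instance k A B"
  then have "csp A B" by unfold_locales (simp add: csp_coverwidth_instance_def)
  then show "\<exists>B'. pkc_result k A B B'" by (rule csp.pkc_result_exists)
  show "reports_inconsistency B' \<longleftrightarrow> \<not> satisfiable A B" if "pkc_result k A B B'" for B'
    using pkc_result_correct[OF inst that] .
qed

end
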